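(* Let $m\ge 1$ be an integer, $n=2m+1$, $\mathfrak{g}=\mathfrak{sl}(n,\mathbb{C})$, and let $H_{i,j}$, $\mathfrak{h}_\perp$ and $\widehat{E}_1,\dots,\widehat{E}_m$ be as defined in the context. Then there is exactly one pair of families $(H_k^\perp)_{k=1}^m$ and $(\widehat{H}_k)_{k=1}^m$ of elements of the diagonal Cartan subalgebra $\mathfrak{h}$ of $\mathfrak{g}$ such that (i) $H_k^\perp\in\mathfrak{h}_\perp$ and $[H_k^\perp,\widehat{E}_l]=\delta_{kl}\,\widehat{E}_k$ for all $k,l=1,\dots,m$; (ii) $\widehat{H}_k\in H_{k,n-k+1}+\mathfrak{h}_\perp$ for all $k=1,\dots,m$; (iii) the element $$r_{ech}=\sum_{k=1}^{m}\Bigl(\widehat{H}_k\wedge E_{k,n-k+1}+\sum_{p=k+1}^{n-k}E_{k,p}\wedge E_{p,n-k+1}\Bigr)+\sum_{k=1}^{m}H_k^\perp\wedge\widehat{E}_k$$ of $\mathfrak{g}\wedge\mathfrak{g}$ is a solution of the classical Yang–Baxter equation. In other words, the full chain of extended Jordanian $r$-matrices for $\mathfrak{sl}(2m+1)$ can be uniquely enlarged by a set of $m$ independent Jordanian terms $H_k^\perp\wedge\widehat{E}_k$.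
   Context: $E_{i,j}$ ($1\le i,j\le n$) denote the matrix units of size $n\times n$. $\mathfrak{h}$ is the Cartan subalgebra of traceless diagonal matrices in $\mathfrak{sl}(n,\mathbb{C})$. Put $H_{i,j}=\tfrac12(E_{i,i}-E_{j,j})$, so that $[H_{i,j},E_{i,j}]=E_{i,j}$. For $x,y\in\mathfrak{g}$, $x\wedge y=x\otimes y-y\otimes x$. An element $r\in\mathfrak{g}\wedge\mathfrak{g}$ is a solution of the classical Yang–Baxter equation if $[r_{12},r_{13}]+[r_{12},r_{23}]+[r_{13},r_{23}]=0$ (in $U(\mathfrak{g})^{\otimes 3}$). Write $e_i$ for the linear functional on diagonal matrices giving the $i$-th diagonal entry, and let $\theta_k=e_k-e_{n-k+1}$, $k=1,\dots,m$. Set $\mathfrak{h}_\perp=\{h\in\mathfrak{h}\mid \theta_k(h)=0 \text{ for } k=1,\dots,m\}$. A full chain (with Cartan elements $\widehat H_k$) is an $r$-matrix of the form $\sum_{k=1}^{m}\bigl(\widehat{H}_k\wedge E_{k,n-k+1}+\sum_{p=k+1}^{n-k}E_{k,p}\wedge E_{p,n-k+1}\bigr)$ where $\widehat{H}_k\in H_{k,n-k+1}+\mathfrak{h}_\perp$; the canonical full chain has $\widehat H_k=H_{k,n-k+1}$. Let $p_0=\frac{m+1}{2}$ if $m$ is odd and $p_0=\frac{m+2}{2}$ if $m$ is even. Define $$\widehat{E}_k=E_{2k,2k-1}+E_{n-2k+1,\,n-2k+2}\quad (1\le k\le m,\ k\ne p_0),\qquad \widehat{E}_{p_0}=E_{2p_0,\,2p_0-1}.$$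 The Jordanian terms added to the chain are those of the form $H_k^\perp\wedge\widehat{E}_k$, with $H_k^\perp\in\mathfrak{h}_\perp$ and $[H_k^\perp,\widehat{E}_l]=\delta_{kl}\widehat{E}_k$. *)

theory Defs
  imports
    "Jordan_Normal_Form.Matrix"
    "HOL-Library.Poly_Mapping"
    "HOL-Library.Product_Plus"
    "HOL-Library.FuncSet"
begin

section \<open>Tensor powers of the universal enveloping algebra\<close>

text \<open>
  Words over an alphabet, written additively so that the convolution product of
  \<^theory>\<open>HOL-Library.Poly_Mapping\<close> turns the finitely supported functions on words into
  the free associative algebra.
\<close>

datatype 'a fword = FWord (letters: "'a list")

instantiation fword :: (type) monoid_add
begin

definition zero_fword :: "'a fword" where
  "zero_fword = FWord []"

definition plus_fword :: "'a fword \<Rightarrow> 'a fword \<Rightarrow> 'a fword" where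
  "plus_fword u v = FWord (letters u @ letters v)"

instance
  by standard (simp_all add: zero_fword_def plus_fword_def)

end

text \<open>
  If \<open>A\<close> is the free complex algebra on \<open>'a\<close>, then \<open>A \<otimes> A\<close> and \<open>A \<otimes> A \<otimes> A\<close> are the monoid
  algebras of pairs and triples of words, the componentwise product of words giving
  \<open>(x \<otimes> y \<otimes> z) (x' \<otimes> y' \<otimes> z') = x x' \<otimes> y y' \<otimes> z z'\<close>.
\<close>

type_synonym 'a free_alg = "'a fword \<Rightarrow>\<^sub>0 complex"
type_synonym 'a free_alg2 = "('a fword \<times> 'a fword) \<Rightarrow>\<^sub>0 complex"
type_synonym 'a free_alg3 = "('a fword \<times> 'a fword \<times> 'a fword) \<Rightarrow>\<^sub>0 complex"

definition free_alg_on :: "'a set \<Rightarrow> 'a free_alg set" where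
  "free_alg_on S = {f. \<forall>w \<in> Poly_Mapping.keys f. set (letters w) \<subseteq> S}"

definition fgen :: "'a \<Rightarrow> 'a free_alg" where
  "fgen x = Poly_Mapping.single (FWord [x]) 1"

definition fconst :: "complex \<Rightarrow> 'a free_alg" where
  "fconst c = Poly_Mapping.single 0 c"

definition tens2 :: "'a free_alg \<Rightarrow> 'a free_alg \<Rightarrow> 'a free_alg2" where
  "tens2 x y = (\<Sum>u\<in>Poly_Mapping.keys x. \<Sum>v\<in>Poly_Mapping.keys y.
     Poly_Mapping.single (u, v) (Poly_Mapping.lookup x u * Poly_Mapping.lookup y v))"

definition tens3 :: "'a free_alg \<Rightarrow> 'a free_alg \<Rightarrow> 'a free_alg \<Rightarrow> 'a free_alg3" where
  "tens3 x y z =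
     (\<Sum>u\<in>Poly_Mapping.keys x. \<Sum>v\<in>Poly_Mapping.keys y. \<Sum>w\<in>Poly_Mapping.keys z.
       Poly_Mapping.single (u, v, w)
         (Poly_Mapping.lookup x u * Poly_Mapping.lookup y v * Poly_Mapping.lookup z w))"

definition mat_comm :: "complex mat \<Rightarrow> complex mat \<Rightarrow> complex mat" where
  "mat_comm A B = A * B - B * A"

text \<open>
  For a Lie algebra \<open>g\<close> of matrices, \<open>U(g)\<close> is the quotient of the free algebra on the set \<open>g\<close>
  by the following two-sided ideal \<open>I\<close>. The first two families of generators identify the linear
  structure of \<open>g\<close> with that of the algebra.
\<close>

inductive_set uea_ideal :: "complex mat set \<Rightarrow> complex mat free_alg set"
  for g :: "complex mat set" where
  gen_add: "x \<in> g \<Longrightarrow> y \<in> g \<Longrightarrow> fgen (x + y) - fgen x - fgen y \<in> uea_ideal g"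
| gen_scale: "x \<in> g \<Longrightarrow> fgen (c \<cdot>\<^sub>m x) - fconst c * fgen x \<in> uea_ideal g"
| gen_comm: "x \<in> g \<Longrightarrow> y \<in> g \<Longrightarrow>
    fgen x * fgen y - fgen y * fgen x - fgen (mat_comm x y) \<in> uea_ideal g"
| zero: "0 \<in> uea_ideal g"
| add: "a \<in> uea_ideal g \<Longrightarrow> b \<in> uea_ideal g \<Longrightarrow> a + b \<in> uea_ideal g"
| mult_left: "a \<in> free_alg_on g \<Longrightarrow> b \<in> uea_ideal g \<Longrightarrow> a * b \<in> uea_ideal g"
| mult_right: "a \<in> uea_ideal g \<Longrightarrow> b \<in> free_alg_on g \<Longrightarrow> a * b \<in> uea_ideal g"

text \<open>
  With \<open>A\<close> the free algebra on \<open>g\<close>, \<open>U(g) \<otimes> U(g) \<otimes> U(g)\<close> is the quotient of \<open>A \<otimes> A \<otimes> A\<close> by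
  \<open>I \<otimes> A \<otimes> A + A \<otimes> I \<otimes> A + A \<otimes> A \<otimes> I\<close>, which is the following set.
\<close>

inductive_set uea3_ideal :: "complex mat set \<Rightarrow> complex mat free_alg3 set"
  for g :: "complex mat set" where
  first: "x \<in> uea_ideal g \<Longrightarrow> y \<in> free_alg_on g \<Longrightarrow> z \<in> free_alg_on g \<Longrightarrow>
    tens3 x y z \<in> uea3_ideal g"
| second: "x \<in> free_alg_on g \<Longrightarrow> y \<in> uea_ideal g \<Longrightarrow> z \<in> free_alg_on g \<Longrightarrow>
    tens3 x y z \<in> uea3_ideal g"
| third: "x \<in> free_alg_on g \<Longrightarrow> y \<in> free_alg_on g \<Longrightarrow> z \<in> uea_ideal g \<Longrightarrow>
    tens3 x y z \<in> uea3_ideal g"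
| zero: "0 \<in> uea3_ideal g"
| add: "s \<in> uea3_ideal g \<Longrightarrow> t \<in> uea3_ideal g \<Longrightarrow> s + t \<in> uea3_ideal g"


section \<open>The classical Yang--Baxter equation\<close>

text \<open>Elements of \<open>g \<otimes> g\<close> are given by representatives in \<open>A \<otimes> A\<close>.\<close>

definition wedge :: "'a \<Rightarrow> 'a \<Rightarrow> 'a free_alg2" where
  "wedge x y = tens2 (fgen x) (fgen y) - tens2 (fgen y) (fgen x)"

definition leg12 :: "'a free_alg2 \<Rightarrow> 'a free_alg3" where
  "leg12 r = (\<Sum>k\<in>Poly_Mapping.keys r.
     Poly_Mapping.single (fst k, snd k, 0) (Poly_Mapping.lookup r k))"

definition leg13 :: "'a free_alg2 \<Rightarrow> 'a free_alg3" where
  "leg13 r = (\<Sum>k\<in>Poly_Mapping.keys r.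
     Poly_Mapping.single (fst k, 0, snd k) (Poly_Mapping.lookup r k))"

definition leg23 :: "'a free_alg2 \<Rightarrow> 'a free_alg3" where
  "leg23 r = (\<Sum>k\<in>Poly_Mapping.keys r.
     Poly_Mapping.single (0, fst k, snd k) (Poly_Mapping.lookup r k))"

definition ring_comm :: "'b::ring \<Rightarrow> 'b \<Rightarrow> 'b" where
  "ring_comm a b = a * b - b * a"

text \<open>The left-hand side vanishes in the quotient \<open>U(g) \<otimes> U(g) \<otimes> U(g)\<close>.\<close>

definition solves_CYBE :: "complex mat set \<Rightarrow> complex mat free_alg2 \<Rightarrow> bool" where
  "solves_CYBE g r \<longleftrightarrow>
     ring_comm (leg12 r) (leg13 r) + ring_comm (leg12 r) (leg23 r)
       + ring_comm (leg13 r) (leg23 r) \<in> uea3_ideal g"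


section \<open>Special linear Lie algebra and Cartan elements\<close>

text \<open>
  Rows and columns are numbered from 1 below, whereas the matrix type indexes them from 0.
\<close>

definition sl :: "nat \<Rightarrow> complex mat set" where
  "sl n = {A \<in> carrier_mat n n. (\<Sum>i<n. A $$ (i, i)) = 0}"

definition cartan :: "nat \<Rightarrow> complex mat set" where
  "cartan n = {A \<in> sl n. diagonal_mat A}"

definition E :: "nat \<Rightarrow> nat \<Rightarrow> nat \<Rightarrow> complex mat" where
  "E n i j = mat n n (\<lambda>(a, b). if Suc a = i \<and> Suc b = j then 1 else 0)"

definition H :: "nat \<Rightarrow> nat \<Rightarrow> nat \<Rightarrow> complex mat" where
  "H n i j = (1 / 2) \<cdot>\<^sub>m (E n i i - E n j j)"

definition e_diag :: "nat \<Rightarrow> complex mat \<Rightarrow> complex" where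
  "e_diag i A = A $$ (i - 1, i - 1)"

definition theta :: "nat \<Rightarrow> nat \<Rightarrow> complex mat \<Rightarrow> complex" where
  "theta n k A = e_diag k A - e_diag (n - k + 1) A"

definition cartan_perp :: "nat \<Rightarrow> nat \<Rightarrow> complex mat set" where
  "cartan_perp m n = {h \<in> cartan n. \<forall>k\<in>{1..m}. theta n k h = 0}"

definition p0 :: "nat \<Rightarrow> nat" where
  "p0 m = (if odd m then (m + 1) div 2 else (m + 2) div 2)"

definition Ehat :: "nat \<Rightarrow> nat \<Rightarrow> nat \<Rightarrow> complex mat" where
  "Ehat m n k =
     (if k = p0 m then E n (2 * k) (2 * k - 1)
      else E n (2 * k) (2 * k - 1) + E n (n - 2 * k + 1) (n - 2 * k + 2))"

definition full_chain :: "nat \<Rightarrow> nat \<Rightarrow> (nat \<Rightarrow> complex mat) \<Rightarrow> complex mat free_alg2" where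
  "full_chain m n Hh =
     (\<Sum>k=1..m. wedge (Hh k) (E n k (n - k + 1))
        + (\<Sum>p=k+1..n-k. wedge (E n k p) (E n p (n - k + 1))))"

definition r_ech ::
  "nat \<Rightarrow> nat \<Rightarrow> (nat \<Rightarrow> complex mat) \<Rightarrow> (nat \<Rightarrow> complex mat) \<Rightarrow> complex mat free_alg2" where
  "r_ech m n Hp Hh = full_chain m n Hh + (\<Sum>k=1..m. wedge (Hp k) (Ehat m n k))"

end

theory Submission
  imports Defs
begin

text \<open>
  On the diagonal traceless matrices put \<open>\<alpha>\<^sub>l(h) = h\<^sub>2\<^sub>l - h\<^sub>2\<^sub>l\<^sub>-\<^sub>1\<close>. The functionals
  \<open>\<theta>\<^sub>1, \<dots>, \<theta>\<^sub>m, \<alpha>\<^sub>1, \<dots>, \<alpha>\<^sub>m\<close> are coordinates there, and condition (i) says that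
  \<open>\<theta>\<^sub>l\<close> vanishes and \<open>\<alpha>\<^sub>l\<close> is \<open>\<delta>\<^sub>k\<^sub>l\<close> on the \<open>k\<close>-th perpendicular element, while (ii) fixes the
  \<open>\<theta>\<^sub>l\<close> of the chain Cartan elements. Evaluating the Yang--Baxter equation in the defining
  representation shows that it forces \<open>\<alpha>\<^sub>l\<close> to vanish on the latter, which settles uniqueness.

  Conversely, let \<open>\<alpha>\<^sub>l\<close> vanish on them. All factors of \<open>r\<close> lie in the parabolic subalgebra with diagonal
  blocks of sizes \<open>2, \<dots>, 2, 1\<close>. This is a Frobenius Lie algebra with the functional
  \<open>f(x) = \<Sum>\<^sub>k x\<^sub>k\<^sub>,\<^sub>n\<^sub>-\<^sub>k\<^sub>+\<^sub>1 + \<Sum>\<^sub>l x\<^sub>2\<^sub>l\<^sub>,\<^sub>2\<^sub>l\<^sub>-\<^sub>1\<close>, and \<open>r\<close> is the inverse of the form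
  \<open>f([x, y])\<close>, so the Yang--Baxter equation is the Jacobi identity.
\<close>


section \<open>Representations and the classical Yang--Baxter element\<close>

lemma poly_mapping_eq_sum_single:
  "f = (\<Sum>k\<in>Poly_Mapping.keys f. Poly_Mapping.single k (Poly_Mapping.lookup f k))"
proof (rule poly_mapping_eqI)
  fix k
  show "Poly_Mapping.lookup f k = Poly_Mapping.lookup
    (\<Sum>k\<in>Poly_Mapping.keys f. Poly_Mapping.single k (Poly_Mapping.lookup f k)) k"
    by (simp add: lookup_sum lookup_single when_def in_keys_iff)
qed

text \<open>Linear functionals on a monoid algebra are given by their values on basis elements.
  Matrix coefficients of words, in one or three tensor slots, and indicators of single basis
  elements are the instances below.\<close>

definition lin_ext :: "('k \<Rightarrow> complex) \<Rightarrow> ('k \<Rightarrow>\<^sub>0 complex) \<Rightarrow> complex" where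
  "lin_ext F f = (\<Sum>k\<in>Poly_Mapping.keys f. Poly_Mapping.lookup f k * F k)"

lemma lin_ext_zero [simp]: "lin_ext F 0 = 0"
  by (simp add: lin_ext_def)

lemma lin_ext_single [simp]: "lin_ext F (Poly_Mapping.single k c) = c * F k"
  by (simp add: lin_ext_def)

lemma lin_ext_add: "lin_ext F (f + g) = lin_ext F f + lin_ext F g"
  unfolding lin_ext_def by (rule setsum_keys_plus_distrib) (simp_all add: algebra_simps)

lemma lin_ext_diff: "lin_ext F (f - g) = lin_ext F f - lin_ext F g"
  using lin_ext_add[of F "f - g" g] by simp

lemma lin_ext_sum: "lin_ext F (\<Sum>a\<in>A. f a) = (\<Sum>a\<in>A. lin_ext F (f a))"
  by (induction A rule: infinite_finite_induct) (simp_all add: lin_ext_add)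

lemma lin_ext_mult:
  "lin_ext F (f * g) = (\<Sum>u\<in>Poly_Mapping.keys f. \<Sum>v\<in>Poly_Mapping.keys g.
     Poly_Mapping.lookup f u * Poly_Mapping.lookup g v * F (u + v))"
proof -
  have "f * g = (\<Sum>u\<in>Poly_Mapping.keys f. \<Sum>v\<in>Poly_Mapping.keys g.
     Poly_Mapping.single (u + v) (Poly_Mapping.lookup f u * Poly_Mapping.lookup g v))"
    by (subst poly_mapping_eq_sum_single[of f], subst poly_mapping_eq_sum_single[of g])
      (simp add: sum_product mult_single)
  then show ?thesis
    by (simp add: lin_ext_sum)
qed

lemma lin_ext_tens3:
  "lin_ext (\<lambda>(u, v, w). F u * G v * K w) (tens3 x y z) = lin_ext F x * lin_ext G y * lin_ext K z"
  unfolding mult.assoc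
  unfolding lin_ext_def[of F] lin_ext_def[of G] lin_ext_def[of K] sum_product
  by (simp add: tens3_def lin_ext_sum sum_distrib_left mult_ac)

text \<open>The entry of the product of the letters, indexed from 0, the empty word giving the
  identity. Working with scalars instead of matrix products makes \<open>word_entry_append\<close>
  hold for letters of any dimension.\<close>

fun word_entry :: "nat \<Rightarrow> complex mat list \<Rightarrow> nat \<Rightarrow> nat \<Rightarrow> complex" where
  "word_entry n [] i j = (if i = j then 1 else 0)"
| "word_entry n (A # w) i j = (\<Sum>k<n. A $$ (i, k) * word_entry n w k j)"

lemma word_entry_append:
  "i < n \<Longrightarrow> word_entry n (u @ v) i j = (\<Sum>k<n. word_entry n u i k * word_entry n v k j)"
proof (induction u arbitrary: i)
  case Nil
  then show ?case
    by (simp add: if_distrib[of "\<lambda>x. x * _"] cong: if_cong)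
next
  case (Cons A u)
  have "word_entry n ((A # u) @ v) i j =
      (\<Sum>k<n. A $$ (i, k) * (\<Sum>l<n. word_entry n u k l * word_entry n v l j))"
    using Cons.IH by simp
  also have "\<dots> = (\<Sum>k<n. \<Sum>l<n. A $$ (i, k) * word_entry n u k l * word_entry n v l j)"
    by (simp add: sum_distrib_left mult.assoc)
  also have "\<dots> = (\<Sum>l<n. \<Sum>k<n. A $$ (i, k) * word_entry n u k l * word_entry n v l j)"
    by (rule sum.swap)
  finally show ?case
    by (simp add: sum_distrib_right)
qed

lemma word_entry_singleton [simp]: "j < n \<Longrightarrow> word_entry n [A] i j = A $$ (i, j)"
  by (simp add: if_distrib[of "\<lambda>x. _ * x"] cong: if_cong)

definition rep :: "nat \<Rightarrow> nat \<Rightarrow> nat \<Rightarrow> complex mat free_alg \<Rightarrow> complex" where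
  "rep n i j = lin_ext (\<lambda>w. word_entry n (letters w) i j)"

lemma rep_fgen: "j < n \<Longrightarrow> rep n i j (fgen A) = A $$ (i, j)"
  by (simp add: rep_def fgen_def del: word_entry.simps)

lemma rep_mult: 
  assumes "i < n"
  shows "rep n i j (a * b) = (\<Sum>k<n. rep n i k a * rep n k j b)"
proof -
  have "rep n i j (a * b) = (\<Sum>u\<in>Poly_Mapping.keys a. \<Sum>v\<in>Poly_Mapping.keys b. \<Sum>k<n.
     (Poly_Mapping.lookup a u * word_entry n (letters u) i k) *
     (Poly_Mapping.lookup b v * word_entry n (letters v) k j))"
    using assms by (simp add: rep_def lin_ext_mult plus_fword_def word_entry_append
      sum_distrib_left mult_ac)
  also have "\<dots> = (\<Sum>u\<in>Poly_Mapping.keys a. \<Sum>k<n. \<Sum>v\<in>Poly_Mapping.keys b.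
     (Poly_Mapping.lookup a u * word_entry n (letters u) i k) *
     (Poly_Mapping.lookup b v * word_entry n (letters v) k j))"
    by (intro sum.cong refl sum.swap)
  also have "\<dots> = (\<Sum>k<n. \<Sum>u\<in>Poly_Mapping.keys a. \<Sum>v\<in>Poly_Mapping.keys b.
     (Poly_Mapping.lookup a u * word_entry n (letters u) i k) *
     (Poly_Mapping.lookup b v * word_entry n (letters v) k j))"
    by (rule sum.swap)
  finally show ?thesis
    by (simp add: rep_def lin_ext_def sum_product)
qed

lemma rep_fconst_mult: "i < n \<Longrightarrow> rep n i j (fconst c * a) = c * rep n i j a"
  by (simp add: rep_mult)
    (simp add: rep_def fconst_def zero_fword_def if_distrib[of "\<lambda>x. _ * x"]
      if_distrib[of "\<lambda>x. x * _"] cong: if_cong)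

text \<open>The map \<open>rep\<close> extends the defining representation of \<open>g\<close> to
  the free algebra. It is linear and sends commutators to commutators, so it kills the generators,
  and multiplicativity handles their multiples. Hence it is well defined on
  \<open>U(g)\<close>.\<close>

lemma rep_uea_ideal:
  assumes g: "g \<subseteq> carrier_mat n n" and "x \<in> uea_ideal g" "i < n" "j < n"
  shows "rep n i j x = 0"
  using assms(2-)
proof (induction arbitrary: i j)
  case (gen_add x y)
  then have "x \<in> carrier_mat n n" "y \<in> carrier_mat n n" using g by auto
  moreover have "rep n i j (fgen (x + y) - fgen x - fgen y) =
      rep n i j (fgen (x + y)) - rep n i j (fgen x) - rep n i j (fgen y)"
    by (simp add: rep_def lin_ext_diff)
  ultimately show ?case using gen_add
    by (simp add: rep_fgen)
next
  case (gen_scale x c)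
  then have "x \<in> carrier_mat n n" using g by auto
  moreover have "rep n i j (fgen (c \<cdot>\<^sub>m x) - fconst c * fgen x) =
      rep n i j (fgen (c \<cdot>\<^sub>m x)) - rep n i j (fconst c * fgen x)"
    by (simp add: rep_def lin_ext_diff)
  ultimately show ?case using gen_scale
    by (simp add: rep_fconst_mult rep_fgen)
next
  case (gen_comm x y)
  then have c: "x \<in> carrier_mat n n" "y \<in> carrier_mat n n" using g by auto
  have "rep n i j (fgen x * fgen y - fgen y * fgen x - fgen (mat_comm x y)) =
      rep n i j (fgen x * fgen y) - rep n i j (fgen y * fgen x) - rep n i j (fgen (mat_comm x y))"
    by (simp add: rep_def lin_ext_diff)
  then show ?case using gen_comm c
    by (simp add: rep_mult rep_fgen mat_comm_def scalar_prod_def lessThan_atLeast0)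
next
  case zero
  then show ?case by (simp add: rep_def)
next
  case (add a b)
  then show ?case by (simp add: rep_def lin_ext_add)
next
  case (mult_left a b)
  then show ?case by (simp add: rep_mult)
next
  case (mult_right a b)
  then show ?case by (simp add: rep_mult)
qed

definition rep3 :: "nat \<Rightarrow> nat \<times> nat \<Rightarrow> nat \<times> nat \<Rightarrow> nat \<times> nat \<Rightarrow> complex mat free_alg3 \<Rightarrow> complex"
  where "rep3 n P Q R = lin_ext (\<lambda>(u, v, w). word_entry n (letters u) (fst P) (snd P) *
     word_entry n (letters v) (fst Q) (snd Q) * word_entry n (letters w) (fst R) (snd R))"

lemma rep3_tens3:
  "rep3 n P Q R (tens3 x y z) =
     rep n (fst P) (snd P) x * rep n (fst Q) (snd Q) y * rep n (fst R) (snd R) z"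
  by (simp add: rep3_def rep_def lin_ext_tens3)

text \<open>This makes the Yang-Baxter equation testable: a solution must have vanishing matrix
  coefficients in the threefold tensor power of the defining representation.\<close>

lemma rep3_uea3_ideal:
  assumes "g \<subseteq> carrier_mat n n" and "t \<in> uea3_ideal g"
    and "fst P < n" "snd P < n" "fst Q < n" "snd Q < n" "fst R < n" "snd R < n"
  shows "rep3 n P Q R t = 0"
  using assms(2)
proof induction
  case (add s t)
  then show ?case by (simp add: rep3_def lin_ext_add)
next
  case zero
  then show ?case by (simp add: rep3_def)
qed (use assms in \<open>simp_all add: rep3_tens3 rep_uea_ideal\<close>)

section \<open>The Yang-Baxter expression of a sum of pure tensors\<close>

definition cybe :: "complex mat free_alg2 \<Rightarrow> complex mat free_alg3" where
  "cybe r = ring_comm (leg12 r) (leg13 r) + ring_comm (leg12 r) (leg23 r)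
       + ring_comm (leg13 r) (leg23 r)"

lemma leg_add:
  "leg12 (r + s) = leg12 r + leg12 s"
  "leg13 (r + s) = leg13 r + leg13 s"
  "leg23 (r + s) = leg23 r + leg23 s"
  unfolding leg12_def leg13_def leg23_def
  by (rule setsum_keys_plus_distrib; simp add: single_add)+

lemma leg_zero: "leg12 0 = 0" "leg13 0 = 0" "leg23 0 = 0"
  by (simp_all add: leg12_def leg13_def leg23_def)

lemma leg_sum:
  "leg12 (\<Sum>a\<in>A. r a) = (\<Sum>a\<in>A. leg12 (r a))"
  "leg13 (\<Sum>a\<in>A. r a) = (\<Sum>a\<in>A. leg13 (r a))"
  "leg23 (\<Sum>a\<in>A. r a) = (\<Sum>a\<in>A. leg23 (r a))"
  by (induction A rule: infinite_finite_induct; simp add: leg_add leg_zero)+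

lemma leg_single:
  "leg12 (Poly_Mapping.single (u, v) c) = Poly_Mapping.single (u, v, 0) c"
  "leg13 (Poly_Mapping.single (u, v) c) = Poly_Mapping.single (u, 0, v) c"
  "leg23 (Poly_Mapping.single (u, v) c) = Poly_Mapping.single (0, u, v) c"
  by (simp_all add: leg12_def leg13_def leg23_def)

abbreviation mono3 :: "'a list \<Rightarrow> 'a list \<Rightarrow> 'a list \<Rightarrow> complex \<Rightarrow> 'a free_alg3" where
  "mono3 u v w \<equiv> Poly_Mapping.single (FWord u, FWord v, FWord w)"

lemma ring_comm_sum:
  "ring_comm (\<Sum>a\<in>A. f a) (\<Sum>b\<in>B. g b) = (\<Sum>a\<in>A. \<Sum>b\<in>B. f a * g b - g b * f a)"
  unfolding ring_comm_def sum_product sum_subtractf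
  by (subst sum.swap[of _ B A]) (rule refl)

text \<open>Two legs share exactly one tensor slot, and elsewhere one of them carries the empty
  word. So each of the three commutators is a commutator of letters in the shared slot, which is
  slot 1, 2 and 3 in turn.\<close>

lemma cybe_sum_single:
  "cybe (\<Sum>a\<in>B. Poly_Mapping.single (FWord [z a], FWord [w a]) (s a)) =
    (\<Sum>a\<in>B. \<Sum>b\<in>B.
      (mono3 [z a, z b] [w a] [w b] (s a * s b) - mono3 [z b, z a] [w a] [w b] (s a * s b))
    + (mono3 [z a] [w a, z b] [w b] (s a * s b) - mono3 [z a] [z b, w a] [w b] (s a * s b))
    + (mono3 [z a] [z b] [w a, w b] (s a * s b) - mono3 [z a] [z b] [w b, w a] (s a * s b)))"
  unfolding cybe_def leg_sum leg_single ring_comm_sum sum.distrib[symmetric]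
  by (simp add: mult_single zero_fword_def plus_fword_def mult.commute)

section \<open>Structure constants\<close>

text \<open>Reading off a coefficient is the linear extension of an indicator, and the indicator of
  a triple is a product of three, so \<open>lin_ext_tens3\<close> applies. Multilinearity of
  \<open>tens3\<close> then becomes a coefficientwise check.\<close>

lemma lookup_tens3:
  "Poly_Mapping.lookup (tens3 x y z) (u, v, w) =
     Poly_Mapping.lookup x u * Poly_Mapping.lookup y v * Poly_Mapping.lookup z w"
proof -
  have pt: "lin_ext (\<lambda>k. if k = l then 1 else 0) f = Poly_Mapping.lookup f l" for f :: "'k \<Rightarrow>\<^sub>0 complex" and l
    by (simp add: lin_ext_def if_distrib[of "\<lambda>x. _ * x"] in_keys_iff cong: if_cong)
  have "(\<lambda>k. if k = (u, v, w) then 1 else 0) =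
      (\<lambda>(a, b, c). (if a = u then 1 else 0) * (if b = v then 1 else 0) * (if c = w then 1 else (0::complex)))"
    by (auto simp: fun_eq_iff)
  from pt[of "(u, v, w)" "tens3 x y z", unfolded this lin_ext_tens3 pt] show ?thesis by simp
qed

lemma tens3_single:
  "tens3 (Poly_Mapping.single u a) (Poly_Mapping.single v b) (Poly_Mapping.single w c) =
     Poly_Mapping.single (u, v, w) (a * b * c)"
  by (rule poly_mapping_eqI) (auto simp: lookup_tens3 lookup_single when_def split: if_splits)

lemma tens3_diff:
  "tens3 (x - x') y z = tens3 x y z - tens3 x' y z"
  "tens3 x (y - y') z = tens3 x y z - tens3 x y' z"
  "tens3 x y (z - z') = tens3 x y z - tens3 x y z'"
  by (rule poly_mapping_eqI, clarsimp simp: lookup_tens3 lookup_minus left_diff_distrib right_diff_distrib)+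

lemma tens3_sum:
  "tens3 (\<Sum>c\<in>C. f c) y z = (\<Sum>c\<in>C. tens3 (f c) y z)"
  "tens3 x (\<Sum>c\<in>C. f c) z = (\<Sum>c\<in>C. tens3 x (f c) z)"
  "tens3 x y (\<Sum>c\<in>C. f c) = (\<Sum>c\<in>C. tens3 x y (f c))"
  by (rule poly_mapping_eqI,
      auto simp: lookup_tens3 lookup_sum sum_distrib_left sum_distrib_right)+

lemma free_alg_on_single:
  "Poly_Mapping.single (FWord u) c \<in> free_alg_on S \<longleftrightarrow> c = 0 \<or> set u \<subseteq> S"
  by (auto simp: free_alg_on_def)

lemma fconst_mult_fgen: "fconst c * fgen x = Poly_Mapping.single (FWord [x]) c"
  by (simp add: fconst_def fgen_def mult_single zero_fword_def plus_fword_def)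

lemma fgen_mult_fgen: "fgen x * fgen y = Poly_Mapping.single (FWord [x, y]) 1"
  by (simp add: fgen_def mult_single plus_fword_def)

lemma uea3_ideal_sum: "(\<And>c. c \<in> C \<Longrightarrow> f c \<in> uea3_ideal g) \<Longrightarrow> (\<Sum>c\<in>C. f c) \<in> uea3_ideal g"
  by (induction C rule: infinite_finite_induct) (simp_all add: uea3_ideal.zero uea3_ideal.add)

section \<open>Linear relations and commutators modulo the ideal\<close>

lemma sl_add: "A \<in> sl n \<Longrightarrow> B \<in> sl n \<Longrightarrow> A + B \<in> sl n"
  by (auto simp: sl_def sum.distrib)

lemma sl_smult: "A \<in> sl n \<Longrightarrow> c \<cdot>\<^sub>m A \<in> sl n"
  by (auto simp: sl_def simp flip: sum_distrib_left)

text \<open>The letters of the free algebra are formal symbols, so a linear relation between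
  matrices holds only modulo the ideal. The induction splits off one summand at a time by
  \<open>gen_add\<close> and \<open>gen_scale\<close>.\<close>

lemma fgen_linear_combination:
  assumes "finite C" "x \<in> sl n" "\<And>c. c \<in> C \<Longrightarrow> v c \<in> sl n"
    and "\<And>i j. i < n \<Longrightarrow> j < n \<Longrightarrow> x $$ (i, j) = (\<Sum>c\<in>C. t c * v c $$ (i, j))"
  shows "fgen x - (\<Sum>c\<in>C. Poly_Mapping.single (FWord [v c]) (t c)) \<in> uea_ideal (sl n)"
  using assms
proof (induction C arbitrary: x rule: finite_induct)
  case empty
  \<comment> \<open>Here \<open>x\<close> is the zero matrix, and \<open>gen_scale\<close> with
    scalar 0 puts its symbol into the ideal.\<close>
  then have "x = 0 \<cdot>\<^sub>m x" by (intro eq_matI) (auto simp: sl_def)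
  with uea_ideal.gen_scale[of x "sl n" 0] empty(1) show ?case
    by (simp add: fconst_mult_fgen)
next
  case (insert c C)
  define y where "y = x + (- t c) \<cdot>\<^sub>m v c"
  have v: "v c \<in> sl n" and y: "y \<in> sl n"
    using insert.prems by (auto simp: y_def intro!: sl_add sl_smult)
  have dims: "x \<in> carrier_mat n n" "v c \<in> carrier_mat n n"
    using insert.prems by (auto simp: sl_def)
  have "fgen y - (\<Sum>c\<in>C. Poly_Mapping.single (FWord [v c]) (t c)) \<in> uea_ideal (sl n)"
    using y insert dims by (intro insert.IH) (auto simp: y_def)
  moreover have "fgen (y + t c \<cdot>\<^sub>m v c) - fgen y - fgen (t c \<cdot>\<^sub>m v c) \<in> uea_ideal (sl n)"
    using y v by (intro uea_ideal.gen_add sl_smult)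
  moreover have "y + t c \<cdot>\<^sub>m v c = x"
    using dims by (intro eq_matI) (auto simp: y_def)
  moreover have "fgen (t c \<cdot>\<^sub>m v c) - Poly_Mapping.single (FWord [v c]) (t c) \<in> uea_ideal (sl n)"
    using uea_ideal.gen_scale[OF v] by (simp add: fconst_mult_fgen)
  ultimately have "(fgen y - (\<Sum>c\<in>C. Poly_Mapping.single (FWord [v c]) (t c))) +
     (fgen x - fgen y - fgen (t c \<cdot>\<^sub>m v c)) +
     (fgen (t c \<cdot>\<^sub>m v c) - Poly_Mapping.single (FWord [v c]) (t c)) \<in> uea_ideal (sl n)"
    by (intro uea_ideal.add) simp_all
  then show ?case using insert.hyps by (simp add: algebra_simps)
qed

lemma trace_mult_comm:
  fixes A B :: "complex mat"
  assumes "A \<in> carrier_mat n n" "B \<in> carrier_mat n n"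
  shows "(\<Sum>i<n. (A * B) $$ (i, i)) = (\<Sum>i<n. (B * A) $$ (i, i))"
proof -
  have "(\<Sum>i<n. (A * B) $$ (i, i)) = (\<Sum>i<n. \<Sum>k<n. A $$ (i, k) * B $$ (k, i))"
    using assms by (simp add: scalar_prod_def lessThan_atLeast0)
  also have "\<dots> = (\<Sum>k<n. \<Sum>i<n. A $$ (i, k) * B $$ (k, i))"
    by (rule sum.swap)
  also have "\<dots> = (\<Sum>i<n. (B * A) $$ (i, i))"
    using assms by (simp add: scalar_prod_def lessThan_atLeast0 mult.commute)
  finally show ?thesis .
qed

lemma sl_mat_comm: "A \<in> sl n \<Longrightarrow> B \<in> sl n \<Longrightarrow> mat_comm A B \<in> sl n"
  using trace_mult_comm[of A n B] by (auto simp: sl_def mat_comm_def sum_subtractf)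

lemma commutator_linear_combination:
  assumes "finite C" "x \<in> sl n" "y \<in> sl n" "\<And>c. c \<in> C \<Longrightarrow> v c \<in> sl n"
    and "\<And>i j. i < n \<Longrightarrow> j < n \<Longrightarrow> mat_comm x y $$ (i, j) = (\<Sum>c\<in>C. t c * v c $$ (i, j))"
  shows "Poly_Mapping.single (FWord [x, y]) 1 - Poly_Mapping.single (FWord [y, x]) 1
     - (\<Sum>c\<in>C. Poly_Mapping.single (FWord [v c]) (t c)) \<in> uea_ideal (sl n)"
  using uea_ideal.add[OF uea_ideal.gen_comm[OF assms(2,3)]
      fgen_linear_combination[OF assms(1) sl_mat_comm[OF assms(2,3)] assms(4,5)]]
  by (simp add: fgen_mult_fgen)

text \<open>Lets a commutator in any one slot be replaced by its linear expansion; \<open>e\<close>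
  carries the scalar coefficient of the surrounding monomial.\<close>

lemma mono3_commutator:
  assumes "finite C" "x \<in> sl n" "y \<in> sl n" "\<And>c. c \<in> C \<Longrightarrow> v c \<in> sl n"
    and "\<And>i j. i < n \<Longrightarrow> j < n \<Longrightarrow> mat_comm x y $$ (i, j) = (\<Sum>c\<in>C. t c * v c $$ (i, j))"
    and "p \<in> sl n" "q \<in> sl n"
  shows "mono3 [x, y] [p] [q] e - mono3 [y, x] [p] [q] e - (\<Sum>c\<in>C. mono3 [v c] [p] [q] (t c * e))
      \<in> uea3_ideal (sl n)"
    and "mono3 [p] [x, y] [q] e - mono3 [p] [y, x] [q] e - (\<Sum>c\<in>C. mono3 [p] [v c] [q] (t c * e))
      \<in> uea3_ideal (sl n)"
    and "mono3 [p] [q] [x, y] e - mono3 [p] [q] [y, x] e - (\<Sum>c\<in>C. mono3 [p] [q] [v c] (t c * e))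
      \<in> uea3_ideal (sl n)"
proof -
  note D = commutator_linear_combination[OF assms(1-5)]
  have g: "Poly_Mapping.single (FWord [p]) a \<in> free_alg_on (sl n)"
    "Poly_Mapping.single (FWord [q]) a \<in> free_alg_on (sl n)" for a
    using assms(6,7) by (simp_all add: free_alg_on_single)
  show "mono3 [x, y] [p] [q] e - mono3 [y, x] [p] [q] e - (\<Sum>c\<in>C. mono3 [v c] [p] [q] (t c * e))
      \<in> uea3_ideal (sl n)"
    using uea3_ideal.first[OF D g(1)[of 1] g(2)[of e]]
    by (simp add: tens3_diff tens3_sum tens3_single)
  show "mono3 [p] [x, y] [q] e - mono3 [p] [y, x] [q] e - (\<Sum>c\<in>C. mono3 [p] [v c] [q] (t c * e))
      \<in> uea3_ideal (sl n)"
    using uea3_ideal.second[OF g(1)[of 1] D g(2)[of e]]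
    by (simp add: tens3_diff tens3_sum tens3_single)
  show "mono3 [p] [q] [x, y] e - mono3 [p] [q] [y, x] e - (\<Sum>c\<in>C. mono3 [p] [q] [v c] (t c * e))
      \<in> uea3_ideal (sl n)"
    using uea3_ideal.third[OF g(1)[of 1] g(2)[of e] D]
    by (simp add: tens3_diff tens3_sum tens3_single mult.commute)
qed

lemma sum_involution:
  assumes "\<And>a. a \<in> B \<Longrightarrow> \<sigma> a \<in> B" "\<And>a. a \<in> B \<Longrightarrow> \<sigma> (\<sigma> a) = a"
  shows "(\<Sum>a\<in>B. f a) = (\<Sum>a\<in>B. f (\<sigma> a))"
  by (rule sum.reindex_bij_witness[of _ \<sigma> \<sigma>]) (use assms in auto)

text \<open>
  Expanding each commutator in the basis dual to \<open>z\<close> turns the Yang--Baxter expression into a sum whose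
  coefficients are the Jacobi sums of \<open>K\<close>.
\<close>

lemma cybe_in_ideal_of_structure_constants:
  fixes K :: "'b \<Rightarrow> 'b \<Rightarrow> 'b \<Rightarrow> complex"
  assumes fin: "finite B"
    and inv: "\<And>a. a \<in> B \<Longrightarrow> \<sigma> a \<in> B" "\<And>a. a \<in> B \<Longrightarrow> \<sigma> (\<sigma> a) = a"
    and s: "\<And>a. a \<in> B \<Longrightarrow> s (\<sigma> a) = - s a"
    and z: "\<And>a. a \<in> B \<Longrightarrow> z a \<in> sl n"
    and comm: "\<And>a b i j. a \<in> B \<Longrightarrow> b \<in> B \<Longrightarrow> i < n \<Longrightarrow> j < n \<Longrightarrow>
      mat_comm (z a) (z b) $$ (i, j) = (\<Sum>c\<in>B. - (K a b c * s c) * z (\<sigma> c) $$ (i, j))"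
    and anti: "\<And>a b c. a \<in> B \<Longrightarrow> b \<in> B \<Longrightarrow> c \<in> B \<Longrightarrow> K b a c = - K a b c"
    and jacobi: "\<And>a b c. a \<in> B \<Longrightarrow> b \<in> B \<Longrightarrow> c \<in> B \<Longrightarrow> K a b c + K b c a + K c a b = 0"
  shows "cybe (\<Sum>a\<in>B. Poly_Mapping.single (FWord [z a], FWord [z (\<sigma> a)]) (s a)) \<in> uea3_ideal (sl n)"
proof -
  define M where "M a b c = mono3 [z (\<sigma> a)] [z (\<sigma> b)] [z (\<sigma> c)]" for a b c
  \<comment> \<open>\<open>T1\<close>, \<open>T2\<close>, \<open>T3\<close> are the expansions of
    the commutators in the first, second and third slot. They are reindexed below until all three
    are sums over the same monomials \<open>M a b c\<close>.\<close>
  define T1 where "T1 a b = (\<Sum>c\<in>B. mono3 [z (\<sigma> c)] [z (\<sigma> a)] [z (\<sigma> b)]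
    (- (K a b c * s c) * (s a * s b)))" for a b
  define T2 where "T2 a b = (\<Sum>c\<in>B. mono3 [z a] [z (\<sigma> c)] [z (\<sigma> b)]
    (- (K (\<sigma> a) b c * s c) * (s a * s b)))" for a b
  define T3 where "T3 a b = (\<Sum>c\<in>B. mono3 [z a] [z b] [z (\<sigma> c)]
    (- (K (\<sigma> a) (\<sigma> b) c * s c) * (s a * s b)))" for a b
  have "cybe (\<Sum>a\<in>B. Poly_Mapping.single (FWord [z a], FWord [z (\<sigma> a)]) (s a)) -
      (\<Sum>a\<in>B. \<Sum>b\<in>B. T1 a b + T2 a b + T3 a b) \<in> uea3_ideal (sl n)"
    unfolding cybe_sum_single sum_subtractf[symmetric]
  proof (intro uea3_ideal_sum, goal_cases)
    case (1 a b)
    note ab = 1 inv(1)[OF 1(1)] inv(1)[OF 1(2)]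
    have "(mono3 [z a, z b] [z (\<sigma> a)] [z (\<sigma> b)] (s a * s b) -
        mono3 [z b, z a] [z (\<sigma> a)] [z (\<sigma> b)] (s a * s b) - T1 a b) +
       (mono3 [z a] [z (\<sigma> a), z b] [z (\<sigma> b)] (s a * s b) -
        mono3 [z a] [z b, z (\<sigma> a)] [z (\<sigma> b)] (s a * s b) - T2 a b) +
       (mono3 [z a] [z b] [z (\<sigma> a), z (\<sigma> b)] (s a * s b) -
        mono3 [z a] [z b] [z (\<sigma> b), z (\<sigma> a)] (s a * s b) - T3 a b) \<in> uea3_ideal (sl n)"
      unfolding T1_def T2_def T3_def using ab
      by (intro uea3_ideal.add mono3_commutator fin z inv(1) comm) simp_all
    then show ?case by (simp add: algebra_simps)
  qed
  moreover have "(\<Sum>a\<in>B. \<Sum>b\<in>B. T1 a b + T2 a b + T3 a b) = 0"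
  proof -
    have "(\<Sum>a\<in>B. \<Sum>b\<in>B. T1 a b) =
        (\<Sum>a\<in>B. \<Sum>b\<in>B. \<Sum>c\<in>B. M c a b (- (K a b c * s c * s a * s b)))"
      by (simp add: T1_def M_def mult.assoc)
    also have "\<dots> = (\<Sum>a\<in>B. \<Sum>c\<in>B. \<Sum>b\<in>B. M c a b (- (K a b c * s c * s a * s b)))"
      by (intro sum.cong refl sum.swap)
    also have "\<dots> = (\<Sum>a\<in>B. \<Sum>b\<in>B. \<Sum>c\<in>B. M a b c (- (K b c a * s a * s b * s c)))"
      by (rule sum.swap)
    finally have 1: "(\<Sum>a\<in>B. \<Sum>b\<in>B. T1 a b) = \<dots>" .
    \<comment> \<open>Replacing \<open>a\<close> by \<open>\<sigma> a\<close> turns the factor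
      \<open>z a\<close> into \<open>z (\<sigma> a)\<close> and costs one sign. The third sum needs
      this in both indices, so its sign is restored.\<close>
    have "(\<Sum>a\<in>B. \<Sum>b\<in>B. T2 a b) = (\<Sum>a\<in>B. \<Sum>b\<in>B. T2 (\<sigma> a) b)"
      by (rule sum_involution[OF inv])
    also have "\<dots> = (\<Sum>a\<in>B. \<Sum>b\<in>B. \<Sum>c\<in>B. M a c b (K a b c * s c * s a * s b))"
      by (intro sum.cong refl) (simp add: T2_def M_def inv s mult.assoc)
    also have "\<dots> = (\<Sum>a\<in>B. \<Sum>b\<in>B. \<Sum>c\<in>B. M a b c (K a c b * s b * s a * s c))"
      by (intro sum.cong refl sum.swap)
    finally have 2: "(\<Sum>a\<in>B. \<Sum>b\<in>B. T2 a b) = \<dots>" .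
    have "(\<Sum>a\<in>B. \<Sum>b\<in>B. T3 a b) = (\<Sum>a\<in>B. \<Sum>b\<in>B. T3 (\<sigma> a) b)"
      by (rule sum_involution[OF inv])
    also have "\<dots> = (\<Sum>a\<in>B. \<Sum>b\<in>B. T3 (\<sigma> a) (\<sigma> b))"
      by (intro sum.cong refl sum_involution[OF inv])
    also have "\<dots> = (\<Sum>a\<in>B. \<Sum>b\<in>B. \<Sum>c\<in>B. M a b c (- (K a b c * s c * s a * s b)))"
      by (intro sum.cong refl) (simp add: T3_def M_def inv s mult.assoc)
    finally have 3: "(\<Sum>a\<in>B. \<Sum>b\<in>B. T3 a b) = \<dots>" .
    have "M a b c (- (K b c a * s a * s b * s c)) + M a b c (K a c b * s b * s a * s c)
        + M a b c (- (K a b c * s c * s a * s b)) = 0"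
      if "a \<in> B" "b \<in> B" "c \<in> B" for a b c
    proof -
      \<comment> \<open>Antisymmetry turns \<open>K a c b\<close> into \<open>- K c a b\<close>,
        which leaves the cyclic Jacobi sum.\<close>
      have "- (K b c a * s a * s b * s c) + K a c b * s b * s a * s c
          + - (K a b c * s c * s a * s b) = - (K a b c + K b c a + K c a b) * (s a * s b * s c)"
        using anti[of c a b] that by (simp add: algebra_simps)
      then show ?thesis
        using jacobi[OF that] unfolding M_def single_add[symmetric] by simp
    qed
    then show ?thesis
      unfolding sum.distrib 1 2 3 unfolding sum.distrib[symmetric] by simp
  qed
  ultimately show ?thesis by simp
qed

section \<open>Entries, diagonal matrices and separation\<close>

text \<open>
  Rows and columns are numbered from 1, as in \<open>E\<close>; index 0 is junk.
\<close>

definition ent :: "complex mat \<Rightarrow> nat \<Rightarrow> nat \<Rightarrow> complex" where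
  "ent A i j = A $$ (i - 1, j - 1)"

lemma ent_mat: "1 \<le> i \<Longrightarrow> i \<le> n \<Longrightarrow> 1 \<le> j \<Longrightarrow> j \<le> n \<Longrightarrow>
    ent (mat n n f) i j = f (i - 1, j - 1)"
  by (simp add: ent_def)

lemma eq_mat_entI:
  assumes "A \<in> carrier_mat n n" "B \<in> carrier_mat n n"
    and "\<And>i j. 1 \<le> i \<Longrightarrow> i \<le> n \<Longrightarrow> 1 \<le> j \<Longrightarrow> j \<le> n \<Longrightarrow> ent A i j = ent B i j"
  shows "A = B"
proof (rule eq_matI)
  fix i j assume "i < dim_row B" "j < dim_col B"
  then show "A $$ (i, j) = B $$ (i, j)"
    using assms(1,2) assms(3)[of "Suc i" "Suc j"] by (simp add: ent_def)
qed (use assms in auto)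

lemma sum_diag_ent: "(\<Sum>i<n. A $$ (i, i)) = (\<Sum>i=1..n. ent A i i)"
  by (simp add: ent_def sum.atLeast1_atMost_eq)

lemma sl_iff: "A \<in> sl n \<longleftrightarrow> A \<in> carrier_mat n n \<and> (\<Sum>i=1..n. ent A i i) = 0"
  by (simp add: sl_def sum_diag_ent)

lemma E_carrier [simp]: "E n i j \<in> carrier_mat n n"
  by (simp add: E_def)

lemma ent_E:
  "1 \<le> a \<Longrightarrow> a \<le> n \<Longrightarrow> 1 \<le> b \<Longrightarrow> b \<le> n \<Longrightarrow> ent (E n i j) a b = (if a = i \<and> b = j then 1 else 0)"
  by (auto simp: E_def ent_mat)

lemma Ehat_carrier [simp]: "Ehat m n k \<in> carrier_mat n n"
  by (simp add: Ehat_def)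

lemma ent_add: "A \<in> carrier_mat n n \<Longrightarrow> B \<in> carrier_mat n n \<Longrightarrow>
    1 \<le> i \<Longrightarrow> i \<le> n \<Longrightarrow> 1 \<le> j \<Longrightarrow> j \<le> n \<Longrightarrow> ent (A + B) i j = ent A i j + ent B i j"
  by (simp add: ent_def)

lemma ent_Ehat:
  assumes "1 \<le> a" "a \<le> n" "1 \<le> b" "b \<le> n"
  shows "ent (Ehat m n k) a b = (if a = 2 * k \<and> b = 2 * k - 1 then 1 else 0) +
    (if k \<noteq> p0 m \<and> a = n - 2 * k + 1 \<and> b = n - 2 * k + 2 then 1 else 0)"
  using assms by (cases "k = p0 m") (simp_all add: Ehat_def ent_E ent_add[of _ n])

lemma mat_comm_carrier [simp]:
  "A \<in> carrier_mat n n \<Longrightarrow> B \<in> carrier_mat n n \<Longrightarrow> mat_comm A B \<in> carrier_mat n n"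
  by (auto simp: mat_comm_def)

lemma ent_mult:
  assumes "A \<in> carrier_mat n n" "B \<in> carrier_mat n n" "1 \<le> i" "i \<le> n" "1 \<le> j" "j \<le> n"
  shows "ent (A * B) i j = (\<Sum>k=1..n. ent A i k * ent B k j)"
  using assms by (simp add: ent_def scalar_prod_def sum.atLeast1_atMost_eq lessThan_atLeast0)

lemma ent_mat_comm:
  assumes "A \<in> carrier_mat n n" "B \<in> carrier_mat n n" "1 \<le> i" "i \<le> n" "1 \<le> j" "j \<le> n"
  shows "ent (mat_comm A B) i j =
    (\<Sum>k=1..n. ent A i k * ent B k j) - (\<Sum>k=1..n. ent B i k * ent A k j)"
proof -
  have "ent (mat_comm A B) i j = ent (A * B) i j - ent (B * A) i j"
    using assms by (simp add: mat_comm_def ent_def)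
  then show ?thesis using assms by (simp add: ent_mult)
qed

lemma ent_mat_comm_E:
  assumes "A \<in> carrier_mat n n" "1 \<le> a" "a \<le> n" "1 \<le> b" "b \<le> n"
    "1 \<le> i" "i \<le> n" "1 \<le> j" "j \<le> n"
  shows "ent (mat_comm A (E n a b)) i j =
    (if j = b then ent A i a else 0) - (if i = a then ent A b j else 0)"
proof -
  have "(\<Sum>k=1..n. ent A i k * ent (E n a b) k j) =
      (\<Sum>k=1..n. if k = a then (if j = b then ent A i k else 0) else 0)"
    using assms by (intro sum.cong) (auto simp: ent_E)
  moreover have "(\<Sum>k=1..n. ent (E n a b) i k * ent A k j) =
      (\<Sum>k=1..n. if k = b then (if i = a then ent A k j else 0) else 0)"
    using assms by (intro sum.cong) (auto simp: ent_E)
  ultimately show ?thesis using assms by (simp add: ent_mat_comm)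
qed

lemma cartanD:
  assumes "h \<in> cartan n"
  shows "h \<in> carrier_mat n n" "h \<in> sl n" "(\<Sum>i=1..n. ent h i i) = 0"
    and "\<And>i j. 1 \<le> i \<Longrightarrow> i \<le> n \<Longrightarrow> 1 \<le> j \<Longrightarrow> j \<le> n \<Longrightarrow> i \<noteq> j \<Longrightarrow> ent h i j = 0"
  using assms by (auto simp: cartan_def sl_iff diagonal_mat_def ent_def)

lemma ent_mat_comm_diag:
  assumes "h \<in> cartan n" "A \<in> carrier_mat n n" "1 \<le> i" "i \<le> n" "1 \<le> j" "j \<le> n"
  shows "ent (mat_comm h A) i j = (ent h i i - ent h j j) * ent A i j"
    and "ent (mat_comm A h) i j = (ent h j j - ent h i i) * ent A i j"
proof -
  have 1: "(\<Sum>k=1..n. ent h i k * ent A k j) = (\<Sum>k=1..n. if k = i then ent h k k * ent A k j else 0)"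
    using assms by (intro sum.cong) (auto simp: cartanD(4)[OF assms(1)])
  have 2: "(\<Sum>k=1..n. ent A i k * ent h k j) = (\<Sum>k=1..n. if k = j then ent A i k * ent h k k else 0)"
    using assms by (intro sum.cong) (auto simp: cartanD(4)[OF assms(1)])
  show "ent (mat_comm h A) i j = (ent h i i - ent h j j) * ent A i j"
    "ent (mat_comm A h) i j = (ent h j j - ent h i i) * ent A i j"
    using assms 1 2 cartanD(1)[OF assms(1)] by (simp_all only: ent_mat_comm)
      (simp_all add: algebra_simps)
qed

definition alpha :: "nat \<Rightarrow> complex mat \<Rightarrow> complex" where
  "alpha l A = ent A (2 * l) (2 * l) - ent A (2 * l - 1) (2 * l - 1)"

lemma theta_ent: "k \<le> n \<Longrightarrow> theta n k A = ent A k k - ent A (n - k + 1) (n - k + 1)"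
  by (simp add: theta_def e_diag_def ent_def)

text \<open>The step from 2j - 1 to 2j is trivial by \<open>al\<close>. Since \<open>n\<close> is
  odd, the reflection i -> n - i + 1 carries the remaining steps, from 2j to 2j + 1, to steps of the
  first kind. So \<open>d\<close> is constant, and the trace condition makes it 0.\<close>

lemma diagonal_separation:
  fixes d :: "nat \<Rightarrow> complex"
  assumes n: "n = 2 * m + 1" and tr: "(\<Sum>i=1..n. d i) = 0"
    and th: "\<And>k. k \<in> {1..m} \<Longrightarrow> d k = d (n - k + 1)"
    and al: "\<And>l. l \<in> {1..m} \<Longrightarrow> d (2 * l) = d (2 * l - 1)"
    and i: "1 \<le> i" "i \<le> n"
  shows "d i = 0"
proof -
  have refl: "d k = d (n - k + 1)" if "1 \<le> k" "k \<le> n" for k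
  proof -
    consider "k \<le> m" | "k = m + 1" | "m + 2 \<le> k" by linarith
    then show ?thesis
    proof cases
      case 1
      then show ?thesis using th that by simp
    next
      case 2
      then show ?thesis using n by simp
    next
      case 3
      then have "n - (n - k + 1) + 1 = k" "n - k + 1 \<in> {1..m}" using that n by auto
      then show ?thesis using th[of "n - k + 1"] by simp
    qed
  qed
  have step: "d (Suc i) = d i" if "1 \<le> i" "i < n" for i
  proof (cases "even i")
    case True
    then obtain j where j: "i = 2 * j" by auto
    define l where "l = m + 1 - j"
    have l: "l \<in> {1..m}" "n - i + 1 = 2 * l" "n - Suc i + 1 = 2 * l - 1"
      using that n j by (auto simp: l_def)
    then show ?thesis using refl[of i] refl[of "Suc i"] al[of l] that by simp
  next
    case False
    then obtain j where "i = 2 * j + 1" by (auto elim: oddE)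
    then show ?thesis using al[of "Suc j"] that n by simp
  qed
  have const: "d i = d 1" if "1 \<le> i" "i \<le> n" for i
    using that
  proof (induction i rule: dec_induct)
    case (step i)
    then show ?case using \<open>\<And>i. 1 \<le> i \<Longrightarrow> i < n \<Longrightarrow> d (Suc i) = d i\<close>[of i] by simp
  qed simp
  have "(\<Sum>i=1..n. d i) = (\<Sum>i=1..n. d 1)"
    by (intro sum.cong refl const) auto
  also have "\<dots> = of_nat n * d 1"
    by simp
  finally have "of_nat n * d 1 = 0"
    unfolding tr by (rule sym)
  moreover have "n \<noteq> 0"
    using n by simp
  ultimately have "d 1 = 0"
    by simp
  with const[OF i] show ?thesis
    by simp
qed

lemma cartan_eqI:
  assumes n: "n = 2 * m + 1" and "h \<in> cartan n" "h' \<in> cartan n"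
    and th: "\<And>k. k \<in> {1..m} \<Longrightarrow> theta n k h = theta n k h'"
    and al: "\<And>l. l \<in> {1..m} \<Longrightarrow> alpha l h = alpha l h'"
  shows "h = h'"
proof -
  have d: "ent h i i - ent h' i i = 0" if "1 \<le> i" "i \<le> n" for i
  proof (rule diagonal_separation[OF n _ _ _ that])
    show "(\<Sum>i=1..n. ent h i i - ent h' i i) = 0"
      by (simp only: sum_subtractf cartanD(3)[OF assms(2)] cartanD(3)[OF assms(3)] diff_self)
    fix k assume "k \<in> {1..m}"
    then show "ent h k k - ent h' k k = ent h (n - k + 1) (n - k + 1) - ent h' (n - k + 1) (n - k + 1)"
      "ent h (2 * k) (2 * k) - ent h' (2 * k) (2 * k) =
       ent h (2 * k - 1) (2 * k - 1) - ent h' (2 * k - 1) (2 * k - 1)"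
      using th[of k] al[of k] n by (simp_all add: theta_ent alpha_def algebra_simps)
  qed
  show ?thesis
  proof (rule eq_mat_entI)
    fix i j assume "1 \<le> i" "i \<le> n" "1 \<le> j" "j \<le> n"
    then show "ent h i j = ent h' i j"
      using d[of i] assms(2,3) by (cases "i = j") (simp_all add: cartanD)
  qed (use assms cartanD in auto)
qed

section \<open>The Yang-Baxter expression in the defining representation\<close>

lemma rep3_add: "rep3 n P Q R (s + t) = rep3 n P Q R s + rep3 n P Q R t"
  by (simp add: rep3_def lin_ext_add)

lemma rep3_diff: "rep3 n P Q R (s - t) = rep3 n P Q R s - rep3 n P Q R t"
  by (simp add: rep3_def lin_ext_diff)

lemma rep3_sum: "rep3 n P Q R (\<Sum>a\<in>A. f a) = (\<Sum>a\<in>A. rep3 n P Q R (f a))"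
  by (simp add: rep3_def lin_ext_sum)

lemma word_entry_pair:
  assumes "A \<in> carrier_mat n n" "B \<in> carrier_mat n n" "i < n" "j < n"
  shows "word_entry n [A, B] i j = (A * B) $$ (i, j)"
  using assms
  by (simp add: scalar_prod_def lessThan_atLeast0 if_distrib[of "\<lambda>x. _ * x"] cong: if_cong)

lemma rep3_cybe:
  assumes z: "\<And>a. a \<in> B \<Longrightarrow> z a \<in> carrier_mat n n" "\<And>a. a \<in> B \<Longrightarrow> w a \<in> carrier_mat n n"
    and P: "fst P < n" "snd P < n" "fst Q < n" "snd Q < n" "fst R < n" "snd R < n"
  shows "rep3 n P Q R (cybe (\<Sum>a\<in>B. Poly_Mapping.single (FWord [z a], FWord [w a]) (s a))) =
    (\<Sum>a\<in>B. \<Sum>b\<in>B. s a * s b *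
      (mat_comm (z a) (z b) $$ P * w a $$ Q * w b $$ R
     + z a $$ P * mat_comm (w a) (z b) $$ Q * w b $$ R
     + z a $$ P * z b $$ Q * mat_comm (w a) (w b) $$ R))"
proof -
  have r: "rep3 n P Q R (mono3 u v w c) = c * (word_entry n u (fst P) (snd P) *
     word_entry n v (fst Q) (snd Q) * word_entry n w (fst R) (snd R))" for u v w c
    by (simp add: rep3_def)
  have c: "mat_comm X Y $$ S = (X * Y) $$ S - (Y * X) $$ S"
    if "X \<in> carrier_mat n n" "Y \<in> carrier_mat n n" "fst S < n" "snd S < n" for X Y S
    using that by (cases S) (simp add: mat_comm_def)
  show ?thesis
    unfolding cybe_sum_single rep3_sum rep3_add rep3_diff r
    by (intro sum.cong refl)
      (use z P in \<open>simp add: c word_entry_pair algebra_simps del: word_entry.simps\<close>)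
qed

lemma sum_sum_delta:
  fixes g :: "'a \<Rightarrow> 'b \<Rightarrow> 'c::comm_monoid_add"
  assumes "finite A" "\<And>k. k \<in> A \<Longrightarrow> finite (C k)"
  shows "(\<Sum>k\<in>A. \<Sum>p\<in>C k. if k = k0 \<and> p = q0 then g k p else 0) =
    (if k0 \<in> A \<and> q0 \<in> C k0 then g k0 q0 else 0)"
proof -
  have "(\<Sum>k\<in>A. \<Sum>p\<in>C k. if k = k0 \<and> p = q0 then g k p else 0) =
      (\<Sum>k\<in>A. if k = k0 then (if q0 \<in> C k then g k q0 else 0) else 0)"
    using assms(2) by (intro sum.cong refl) auto
  then show ?thesis using assms(1) by simp
qed

section \<open>The enlarged chain\<close>

text \<open>Conditions (i) and (ii) of the theorem in the coordinates \<open>theta\<close> and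
  \<open>alpha\<close>; the Yang-Baxter equation is not assumed. The translation is
  \<open>enlarged_chainI\<close>.\<close>

locale enlarged_chain =
  fixes m n :: nat and Hp Hh :: "nat \<Rightarrow> complex mat"
  assumes m: "1 \<le> m" and n: "n = 2 * m + 1"
    and Hp: "\<And>k. k \<in> {1..m} \<Longrightarrow> Hp k \<in> cartan n"
    and Hh: "\<And>k. k \<in> {1..m} \<Longrightarrow> Hh k \<in> cartan n"
    and theta_Hp: "\<And>j k. j \<in> {1..m} \<Longrightarrow> k \<in> {1..m} \<Longrightarrow> theta n j (Hp k) = 0"
    and alpha_Hp: "\<And>l k. l \<in> {1..m} \<Longrightarrow> k \<in> {1..m} \<Longrightarrow> alpha l (Hp k) = (if k = l then 1 else 0)"
    and theta_Hh: "\<And>j k. j \<in> {1..m} \<Longrightarrow> k \<in> {1..m} \<Longrightarrow> theta n j (Hh k) = (if k = j then 1 else 0)"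
begin

lemma n_bounds: "2 * m < n" "n \<le> 2 * m + 1"
  using n by simp_all

text \<open>
  The index \<open>(k, p)\<close> stands for the summand \<open>Hp k \<and> Ehat k\<close> if \<open>p = 0\<close>, for
  \<open>Hh k \<and> E k (n-k+1)\<close> if \<open>p = n-k+1\<close>, and for \<open>E k p \<and> E p (n-k+1)\<close> otherwise; the
  Boolean selects the left or the right factor.
\<close>

definition idx :: "((nat \<times> nat) \<times> bool) set" where
  "idx = (SIGMA k:{1..m}. insert 0 {k+1..n-k+1}) \<times> UNIV"

definition flip :: "(nat \<times> nat) \<times> bool \<Rightarrow> (nat \<times> nat) \<times> bool" where
  "flip b = (fst b, \<not> snd b)"

definition sgnb :: "(nat \<times> nat) \<times> bool \<Rightarrow> complex" where
  "sgnb b = (if snd b then 1 else - 1)"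

definition lgen :: "nat \<Rightarrow> nat \<Rightarrow> complex mat" where
  "lgen k p = (if p = 0 then Hp k else if p = n - k + 1 then Hh k else E n k p)"

definition rgen :: "nat \<Rightarrow> nat \<Rightarrow> complex mat" where
  "rgen k p = (if p = 0 then Ehat m n k else if p = n - k + 1 then E n k p else E n p (n - k + 1))"

definition gen :: "(nat \<times> nat) \<times> bool \<Rightarrow> complex mat" where
  "gen b = (case b of ((k, p), t) \<Rightarrow> if t then lgen k p else rgen k p)"

lemma finite_idx: "finite idx"
  by (auto simp: idx_def)

lemma flip: "b \<in> idx \<Longrightarrow> flip b \<in> idx" "flip (flip b) = b" "sgnb (flip b) = - sgnb b"
  by (auto simp: idx_def flip_def sgnb_def)

lemma sum_idx:
  fixes g :: "(nat \<times> nat) \<times> bool \<Rightarrow> 'c::comm_monoid_add"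
  shows "(\<Sum>b\<in>idx. g b) = (\<Sum>k=1..m. (\<Sum>t\<in>UNIV. g ((k, 0), t)) +
    ((\<Sum>t\<in>UNIV. g ((k, n - k + 1), t)) + (\<Sum>p=k+1..n-k. \<Sum>t\<in>UNIV. g ((k, p), t))))"
proof -
  have "(\<Sum>b\<in>idx. g b) = (\<Sum>k=1..m. \<Sum>p\<in>insert 0 {k+1..n-k+1}. \<Sum>t\<in>UNIV. g ((k, p), t))"
  proof -
    have "(\<Sum>k=1..m. \<Sum>p\<in>insert 0 {k+1..n-k+1}. \<Sum>t\<in>UNIV. g ((k, p), t)) =
        (\<Sum>(k, p)\<in>(SIGMA k:{1..m}. insert 0 {k+1..n-k+1}). \<Sum>t\<in>UNIV. g ((k, p), t))"
      by (rule sum.Sigma) auto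
    also have "\<dots> = (\<Sum>i\<in>(SIGMA k:{1..m}. insert 0 {k+1..n-k+1}). \<Sum>t\<in>UNIV. g (i, t))"
      by (simp only: split_def prod.collapse)
    also have "\<dots> = (\<Sum>b\<in>idx. g b)"
      unfolding idx_def sum.cartesian_product by (simp only: split_def prod.collapse)
    finally show ?thesis
      by (rule sym)
  qed
  also have "\<dots> = (\<Sum>k=1..m. (\<Sum>t\<in>UNIV. g ((k, 0), t)) +
    ((\<Sum>t\<in>UNIV. g ((k, n - k + 1), t)) + (\<Sum>p=k+1..n-k. \<Sum>t\<in>UNIV. g ((k, p), t))))"
  proof (rule sum.cong[OF refl])
    fix k assume "k \<in> {1..m}"
    then have "{k+1..n-k+1} = insert (n - k + 1) {k+1..n-k}"
      using n by auto
    then show "(\<Sum>p\<in>insert 0 {k+1..n-k+1}. \<Sum>t\<in>UNIV. g ((k, p), t)) =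
        (\<Sum>t\<in>UNIV. g ((k, 0), t)) +
        ((\<Sum>t\<in>UNIV. g ((k, n - k + 1), t)) + (\<Sum>p=k+1..n-k. \<Sum>t\<in>UNIV. g ((k, p), t)))"
      by simp
  qed
  finally show ?thesis .
qed

lemma wedge_eq: "wedge x y = Poly_Mapping.single (FWord [x], FWord [y]) 1 +
    Poly_Mapping.single (FWord [y], FWord [x]) (- 1)"
  by (simp add: wedge_def tens2_def fgen_def single_uminus)

text \<open>The form shared by \<open>rep3_cybe\<close> and
  \<open>cybe_in_ideal_of_structure_constants\<close>: each wedge contributes its two ordered
  tensors, exchanged by \<open>flip\<close>, with opposite signs.\<close>

lemma r_ech_eq: "r_ech m n Hp Hh =
    (\<Sum>b\<in>idx. Poly_Mapping.single (FWord [gen b], FWord [gen (flip b)]) (sgnb b))"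
proof -
  have "(\<Sum>t\<in>UNIV. Poly_Mapping.single (FWord [gen ((k, p), t)], FWord [gen (flip ((k, p), t))])
      (sgnb ((k, p), t))) = wedge (lgen k p) (rgen k p)" for k p
    by (simp add: UNIV_bool gen_def flip_def sgnb_def wedge_eq add.commute)
  then have "(\<Sum>b\<in>idx. Poly_Mapping.single (FWord [gen b], FWord [gen (flip b)]) (sgnb b)) =
      (\<Sum>k=1..m. wedge (lgen k 0) (rgen k 0) + (wedge (lgen k (n - k + 1)) (rgen k (n - k + 1)) +
      (\<Sum>p=k+1..n-k. wedge (lgen k p) (rgen k p))))"
    by (simp only: sum_idx)
  also have "\<dots> = (\<Sum>k=1..m. wedge (Hp k) (Ehat m n k) + (wedge (Hh k) (E n k (n - k + 1)) +
      (\<Sum>p=k+1..n-k. wedge (E n k p) (E n p (n - k + 1)))))"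
    by (intro sum.cong refl arg_cong2[of _ _ _ _ "(+)"]) (auto simp: lgen_def rgen_def)
  finally show ?thesis
    by (simp add: r_ech_def full_chain_def sum.distrib add_ac)
qed

lemma sl_E: "1 \<le> i \<Longrightarrow> i \<noteq> j \<Longrightarrow> E n i j \<in> sl n"
  by (auto simp: sl_iff ent_E intro!: sum.neutral)

lemma sl_Ehat: "k \<in> {1..m} \<Longrightarrow> Ehat m n k \<in> sl n"
  using n_bounds by (auto simp: Ehat_def intro!: sl_E sl_add)

lemma gen_cases:
  assumes "b \<in> idx"
  obtains (Hp) k where "k \<in> {1..m}" "b = ((k, 0), True)" "gen b = Hp k"
  | (Hh) k where "k \<in> {1..m}" "b = ((k, n - k + 1), True)" "gen b = Hh k"
  | (lower) k p where "k \<in> {1..m}" "k < p" "p \<le> n - k" "b = ((k, p), True)" "gen b = E n k p"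
  | (Ehat) k where "k \<in> {1..m}" "b = ((k, 0), False)" "gen b = Ehat m n k"
  | (E) k where "k \<in> {1..m}" "b = ((k, n - k + 1), False)" "gen b = E n k (n - k + 1)"
  | (upper) k p where "k \<in> {1..m}" "k < p" "p \<le> n - k" "b = ((k, p), False)" "gen b = E n p (n - k + 1)"
proof -
  obtain k p t where b: "b = ((k, p), t)" by (metis surj_pair)
  then have k: "k \<in> {1..m}" and p: "p = 0 \<or> k < p \<and> p \<le> n - k \<or> p = n - k + 1"
    using assms n_bounds by (auto simp: idx_def)
  have g: "gen b = (if t then lgen k p else rgen k p)" by (simp add: gen_def b)
  from p consider "p = 0" | "p = n - k + 1" | "k < p" "p \<le> n - k" by blast
  then show thesis
  proof cases
    case 1
    then show ?thesis using k g b that(1,4) by (cases t) (simp_all add: lgen_def rgen_def)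
  next
    case 2
    then show ?thesis using k g b that(2,5) by (cases t) (simp_all add: lgen_def rgen_def)
  next
    case 3
    then show ?thesis using k g b that(3,6) by (cases t) (simp_all add: lgen_def rgen_def)
  qed
qed

lemma gen_sl: "b \<in> idx \<Longrightarrow> gen b \<in> sl n"
  by (erule gen_cases)
    (use n_bounds in \<open>auto simp: sl_E sl_Ehat cartanD(2)[OF Hp] cartanD(2)[OF Hh]\<close>)

lemma gen_carrier: "b \<in> idx \<Longrightarrow> gen b \<in> carrier_mat n n"
  using gen_sl by (auto simp: sl_iff)

text \<open>Position (2l, 2l - 1) lies below the diagonal. The chain root vectors and the second
  summands of the \<open>Ehat\<close> lie above it and Cartan elements on it, so only
  \<open>Ehat m n l\<close> is seen.\<close>

lemma ent_gen_Ehat: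
  assumes l: "l \<in> {1..m}" and b: "b \<in> idx"
  shows "ent (gen b) (2 * l) (2 * l - 1) = (if b = ((l, 0), False) then 1 else 0)"
proof -
  have l': "1 \<le> 2 * l" "2 * l \<le> n" "1 \<le> 2 * l - 1" "2 * l - 1 \<le> n" "2 * l \<noteq> 2 * l - 1"
    using l n_bounds by auto
  show ?thesis
    using b
  proof (cases rule: gen_cases)
    case (Hp k)
    then show ?thesis using cartanD(4)[OF enlarged_chain.Hp[OF enlarged_chain_axioms Hp(1)] l'] by simp
  next
    case (Hh k)
    then show ?thesis using cartanD(4)[OF enlarged_chain.Hh[OF enlarged_chain_axioms Hh(1)] l'] by simp
  next
    case (Ehat k)
    have "\<not> (2 * l = n - 2 * k + 1 \<and> 2 * l - 1 = n - 2 * k + 2)"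
      by linarith
    moreover have "(2 * l = 2 * k \<and> 2 * l - 1 = 2 * k - 1) = (k = l)"
      by auto
    ultimately show ?thesis
      unfolding Ehat(3) ent_Ehat[OF l'(1-4)] by (simp add: Ehat(2))
  next
    case (lower k p)
    then have "\<not> (2 * l = k \<and> 2 * l - 1 = p)"
      by linarith
    then show ?thesis unfolding lower(5) ent_E[OF l'(1-4)] by (simp add: lower(4))
  next
    case (E k)
    then have "\<not> (2 * l = k \<and> 2 * l - 1 = n - k + 1)"
      using n_bounds by auto
    then show ?thesis using E(1) n_bounds unfolding E(3) ent_E[OF l'(1-4)] by (simp add: E(2))
  next
    case (upper k p)
    then have "\<not> (2 * l = p \<and> 2 * l - 1 = n - k + 1)"
      by linarith
    then show ?thesis using upper(2) unfolding upper(5) ent_E[OF l'(1-4)] by (simp add: upper(4))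
  qed
qed

text \<open>Position (k, n - k + 1) has index sum n + 1. The left chain factors
  \<open>E n j p\<close> have a smaller sum, the right ones \<open>E n p (n - j + 1)\<close> a
  larger one, and the units in the \<open>Ehat\<close> miss it.\<close>

lemma ent_gen_E:
  assumes k: "k \<in> {1..m}" and b: "b \<in> idx"
  shows "ent (gen b) k (n - k + 1) = (if b = ((k, n - k + 1), False) then 1 else 0)"
proof -
  have k': "1 \<le> k" "k \<le> n" "1 \<le> n - k + 1" "n - k + 1 \<le> n" "k \<noteq> n - k + 1"
    using k n_bounds by auto
  show ?thesis
    using b
  proof (cases rule: gen_cases)
    case (Hp j)
    then show ?thesis using cartanD(4)[OF enlarged_chain.Hp[OF enlarged_chain_axioms Hp(1)] k'] by simp
  next
    case (Hh j)
    then show ?thesis using cartanD(4)[OF enlarged_chain.Hh[OF enlarged_chain_axioms Hh(1)] k'] by simp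
  next
    case (Ehat j)
    \<comment> \<open>The index sum of this unit is 2n - 4j + 3, and equality with n + 1 would make
      \<open>n\<close> even.\<close>
    have "\<not> (k = n - 2 * j + 1 \<and> n - k + 1 = n - 2 * j + 2)"
      using Ehat(1) k n by simp presburger
    moreover have "\<not> (k = 2 * j \<and> n - k + 1 = 2 * j - 1)"
      using Ehat(1) k n by auto
    ultimately show ?thesis using ent_Ehat[OF k'(1-4), of m j] Ehat(2,3) by auto
  next
    case (lower j p)
    then show ?thesis using ent_E[OF k'(1-4), of j p] k n_bounds by auto
  next
    case (E j)
    then show ?thesis using ent_E[OF k'(1-4), of j "n - j + 1"] k n_bounds by auto
  next
    case (upper j p)
    then show ?thesis using ent_E[OF k'(1-4), of p "n - j + 1"] k n_bounds by auto
  qed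
qed

text \<open>
  Evaluate the equation by the functionals picking the entry \<open>(2l, 2l-1)\<close>, the entry \<open>(k, n-k+1)\<close>
  and \<open>alpha l\<close> in the three tensor factors. The first two see only \<open>Ehat l\<close> and \<open>E k (n-k+1)\<close>, so
  the only surviving contribution is the one of the bracket of \<open>Hh k\<close> with \<open>Ehat l\<close>.
\<close>

lemma alpha_Hh_of_CYBE:
  assumes cybe: "solves_CYBE (sl n) (r_ech m n Hp Hh)" and k: "k \<in> {1..m}" and l: "l \<in> {1..m}"
  shows "alpha l (Hh k) = 0"
proof -
  let ?k = "n - k + 1" and ?e = "((l, 0), False)" and ?f = "((k, n - k + 1), False)"
  \<comment> \<open>\<open>T g\<close> applies the first two functionals to the first two slots and
    \<open>g\<close> to the third. Leaving \<open>g\<close> open allows \<open>alpha l\<close> to be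
    assembled from two diagonal matrix coefficients, which is what \<open>rep3\<close>
    provides.\<close>
  define T where "T g = (\<Sum>a\<in>idx. \<Sum>b\<in>idx. sgnb a * sgnb b *
    (ent (mat_comm (gen a) (gen b)) (2 * l) (2 * l - 1) * ent (gen (flip a)) k ?k * g (gen (flip b))
   + ent (gen a) (2 * l) (2 * l - 1) * ent (mat_comm (gen (flip a)) (gen b)) k ?k * g (gen (flip b))
   + ent (gen a) (2 * l) (2 * l - 1) * ent (gen b) k ?k * g (mat_comm (gen (flip a)) (gen (flip b)))))"
    for g :: "complex mat \<Rightarrow> complex"
  have T0: "T (\<lambda>A. ent A i i) = 0" if "1 \<le> i" "i \<le> n" for i
  proof -
    have "rep3 n (2 * l - 1, 2 * l - 2) (k - 1, n - k) (i - 1, i - 1) (cybe (r_ech m n Hp Hh)) = 0"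
      using cybe k l n_bounds that unfolding solves_CYBE_def cybe_def[symmetric]
      by (intro rep3_uea3_ideal[of "sl n"]) (auto simp: sl_iff)
    then show ?thesis
      unfolding r_ech_eq T_def
      by (subst (asm) rep3_cybe)
        (use k l n_bounds that in \<open>auto simp: gen_carrier flip ent_def numeral_2_eq_2\<close>)
  qed
  have e: "?e \<in> idx" "?f \<in> idx" using k l n_bounds by (auto simp: idx_def)
  have g: "gen (flip ?e) = Hp l" "gen (flip ?f) = Hh k"
    by (simp_all add: flip_def gen_def lgen_def)
  have "0 = T (\<lambda>A. ent A (2 * l) (2 * l)) - T (\<lambda>A. ent A (2 * l - 1) (2 * l - 1))"
    using T0[of "2 * l"] T0[of "2 * l - 1"] l n_bounds by auto
  also have "\<dots> = T (alpha l)"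
    unfolding T_def alpha_def sum_subtractf[symmetric] by (intro sum.cong refl) (simp add: algebra_simps)
  also have "\<dots> = (\<Sum>a\<in>idx. \<Sum>b\<in>idx. if a = flip ?f \<and> b = ?e then - alpha l (Hh k) else 0)"
    unfolding T_def
  proof (intro sum.cong refl)
    fix a b assume ab: "a \<in> idx" "b \<in> idx"
    have ii: "1 \<le> 2 * l - 1" "2 * l \<le> n" "1 \<le> k" "k \<le> n" "1 \<le> ?k" "?k \<le> n"
      using k l n_bounds by auto
    have a: "ent (gen a) (2 * l) (2 * l - 1) = (if a = ?e then 1 else 0)"
      "ent (gen b) (2 * l) (2 * l - 1) = (if b = ?e then 1 else 0)"
      "ent (gen b) k ?k = (if b = ?f then 1 else 0)"
      using ent_gen_Ehat[OF l] ent_gen_E[OF k] ab by auto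
    have a': "ent (gen (flip a)) k ?k = (if a = flip ?f then 1 else 0)"
      using ent_gen_E[OF k flip(1)[OF ab(1)]] flip(2) by metis
    have 1: "ent (mat_comm (Hh k) (gen b)) (2 * l) (2 * l - 1) = (if b = ?e then alpha l (Hh k) else 0)"
      using ent_mat_comm_diag(1)[OF Hh[OF k] gen_carrier[OF ab(2)], of "2 * l" "2 * l - 1"] ii a(2)
      by (simp add: alpha_def)
    \<comment> \<open>\<open>Hp l\<close> acts on this entry by its \<open>theta n k\<close>, which
      is 0 by condition (i).\<close>
    have 2: "ent (mat_comm (Hp l) (gen b)) k ?k = 0"
      using ent_mat_comm_diag(1)[OF Hp[OF l] gen_carrier[OF ab(2)], of k ?k] ii theta_Hp[OF k l]
      by (simp add: theta_ent)
    have 3: "alpha l (mat_comm (Hp l) (Hh k)) = 0"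
      using ent_mat_comm_diag(1)[OF Hp[OF l] cartanD(1)[OF Hh[OF k]]] ii by (simp add: alpha_def)
    \<comment> \<open>The entry of \<open>gen (flip a)\<close> forces \<open>gen a\<close> to be
      \<open>Hh k\<close>; the bracket then needs \<open>gen b\<close> to be
      \<open>Ehat m n l\<close>, whose partner \<open>Hp l\<close> has \<open>alpha l\<close> equal
      to 1.\<close>
    have t1: "ent (mat_comm (gen a) (gen b)) (2 * l) (2 * l - 1) * (if a = flip ?f then 1 else 0) *
        alpha l (gen (flip b)) = (if a = flip ?f \<and> b = ?e then alpha l (Hh k) else 0)"
    proof (cases "a = flip ?f")
      case True
      then have ga: "gen a = Hh k" by (simp only: g)
      show ?thesis unfolding ga 1
        by (cases "b = ?e") (simp_all only: True g alpha_Hp[OF l l] simp_thms if_True if_False mult_1_right mult_zero_left)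
    qed simp
    have t2: "(if a = ?e then 1 else 0) * ent (mat_comm (gen (flip a)) (gen b)) k ?k * alpha l (gen (flip b)) = 0"
      by (cases "a = ?e") (simp_all only: g 2 if_False mult_zero_left mult_zero_right)
    have t3: "(if a = ?e then 1 else 0) * (if b = ?f then 1 else 0) *
        alpha l (mat_comm (gen (flip a)) (gen (flip b))) = 0"
      by (cases "a = ?e"; cases "b = ?f") (simp_all only: g 3 if_False mult_zero_left mult_zero_right)
    have sg: "sgnb (flip ?f) * sgnb ?e = - 1"
      by (simp add: sgnb_def flip_def)
    show "sgnb a * sgnb b *
       (ent (mat_comm (gen a) (gen b)) (2 * l) (2 * l - 1) * ent (gen (flip a)) k ?k * alpha l (gen (flip b))
      + ent (gen a) (2 * l) (2 * l - 1) * ent (mat_comm (gen (flip a)) (gen b)) k ?k * alpha l (gen (flip b))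
      + ent (gen a) (2 * l) (2 * l - 1) * ent (gen b) k ?k * alpha l (mat_comm (gen (flip a)) (gen (flip b))))
      = (if a = flip ?f \<and> b = ?e then - alpha l (Hh k) else 0)"
      unfolding a(1,3) a' t1 t2 t3
      by (cases "a = flip ?f \<and> b = ?e") (simp_all only: sg, simp_all)
  qed
  also have "\<dots> = - alpha l (Hh k)"
    using e flip(1)[OF e(2)] finite_idx by (simp add: sum_sum_delta)
  finally show ?thesis by simp
qed

end

section \<open>The Frobenius functional on the parabolic subalgebra\<close>

text \<open>
  The form \<open>frob m n [x, y]\<close> pairs each left factor of \<open>r_ech\<close> with its right factor, and all other
  products of factors vanish.
\<close>

definition frob :: "nat \<Rightarrow> nat \<Rightarrow> complex mat \<Rightarrow> complex" where
  "frob m n A = (\<Sum>k=1..m. ent A k (n - k + 1)) + (\<Sum>l=1..m. ent A (2 * l) (2 * l - 1))"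

definition allowed :: "nat \<Rightarrow> nat \<Rightarrow> bool" where
  "allowed i j \<longleftrightarrow> i \<le> j \<or> even i \<and> i = Suc j"

text \<open>Two successive steps below the diagonal would need two consecutive even row indices.
  Hence the pattern of \<open>par n\<close> is closed under products.\<close>

lemma allowed_trans: "allowed i k \<Longrightarrow> allowed k j \<Longrightarrow> allowed i j"
  unfolding allowed_def by presburger

definition par :: "nat \<Rightarrow> complex mat set" where
  "par n = {x \<in> sl n. \<forall>i\<in>{1..n}. \<forall>j\<in>{1..n}. \<not> allowed i j \<longrightarrow> ent x i j = 0}"

lemma parD:
  assumes "x \<in> par n"
  shows "x \<in> sl n" "x \<in> carrier_mat n n"
    and "1 \<le> i \<Longrightarrow> i \<le> n \<Longrightarrow> 1 \<le> j \<Longrightarrow> j \<le> n \<Longrightarrow> \<not> allowed i j \<Longrightarrow> ent x i j = 0"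
  using assms by (auto simp: par_def sl_iff)

lemma par_mat_comm:
  assumes x: "x \<in> par n" and y: "y \<in> par n"
  shows "mat_comm x y \<in> par n"
proof -
  have "ent (mat_comm x y) i j = 0" if "1 \<le> i" "i \<le> n" "1 \<le> j" "j \<le> n" "\<not> allowed i j" for i j
  proof -
    have z: "ent u i k * ent v k j = 0" if "u \<in> par n" "v \<in> par n" "k \<in> {1..n}" for u v k
    proof -
      have "\<not> allowed i k \<or> \<not> allowed k j"
        using allowed_trans \<open>\<not> allowed i j\<close> by blast
      then show ?thesis
        using parD(3)[OF that(1), of i k] parD(3)[OF that(2), of k j] that(3)
          \<open>1 \<le> i\<close> \<open>i \<le> n\<close> \<open>1 \<le> j\<close> \<open>j \<le> n\<close> by auto
    qed
    have "(\<Sum>k=1..n. ent x i k * ent y k j) = 0" "(\<Sum>k=1..n. ent y i k * ent x k j) = 0"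
      by (intro sum.neutral ballI z x y; assumption)+
    then show ?thesis
      by (simp only: ent_mat_comm[OF parD(2)[OF x] parD(2)[OF y] that(1-4)] diff_self)
  qed
  moreover have "mat_comm x y \<in> sl n"
    using x y by (intro sl_mat_comm parD)
  ultimately show ?thesis by (simp add: par_def)
qed

lemma ent_mat_comm_mat_comm:
  assumes abc: "a \<in> carrier_mat n n" "b \<in> carrier_mat n n" "c \<in> carrier_mat n n"
    and ij: "1 \<le> i" "i \<le> n" "1 \<le> j" "j \<le> n"
  shows "ent (mat_comm (mat_comm a b) c) i j =
    ent (a * b * c) i j - ent (b * a * c) i j - ent (c * a * b) i j + ent (c * b * a) i j"
proof -
  have "mat_comm (mat_comm a b) c = (a * b * c - b * a * c) - (c * a * b - c * b * a)"
    unfolding mat_comm_def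
    using abc by (simp add: minus_mult_distrib_mat[of _ n n] mult_minus_distrib_mat[of c n n "a * b" n "b * a"]
      assoc_mult_mat[of _ n n _ n _ n])
  then show ?thesis
    using abc ij by (simp add: ent_def)
qed

text \<open>These are the two identities that \<open>cybe_in_ideal_of_structure_constants\<close>
  asks of \<open>K a b c\<close> = f([[a, b], c]). They hold entrywise, by cancellation of triple
  products.\<close>

lemma frob_jacobi:
  assumes n: "n = 2 * m + 1" and abc: "a \<in> carrier_mat n n" "b \<in> carrier_mat n n" "c \<in> carrier_mat n n"
  shows "frob m n (mat_comm (mat_comm a b) c) + frob m n (mat_comm (mat_comm b c) a)
    + frob m n (mat_comm (mat_comm c a) b) = 0"
    and "frob m n (mat_comm (mat_comm b a) c) = - frob m n (mat_comm (mat_comm a b) c)"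
proof -
  have j: "ent (mat_comm (mat_comm a b) c) i j + ent (mat_comm (mat_comm b c) a) i j
      + ent (mat_comm (mat_comm c a) b) i j = 0"
    "ent (mat_comm (mat_comm b a) c) i j = - ent (mat_comm (mat_comm a b) c) i j"
    if "1 \<le> i" "i \<le> n" "1 \<le> j" "j \<le> n" for i j
    using that abc by (simp_all add: ent_mat_comm_mat_comm)
  have "frob m n (mat_comm (mat_comm a b) c) + frob m n (mat_comm (mat_comm b c) a)
    + frob m n (mat_comm (mat_comm c a) b) =
    (\<Sum>k=1..m. ent (mat_comm (mat_comm a b) c) k (n - k + 1)
      + ent (mat_comm (mat_comm b c) a) k (n - k + 1) + ent (mat_comm (mat_comm c a) b) k (n - k + 1))
    + (\<Sum>l=1..m. ent (mat_comm (mat_comm a b) c) (2 * l) (2 * l - 1)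
      + ent (mat_comm (mat_comm b c) a) (2 * l) (2 * l - 1)
      + ent (mat_comm (mat_comm c a) b) (2 * l) (2 * l - 1))" (is "_ = ?S + ?T")
    by (simp only: frob_def sum.distrib add_ac)
  also have "?S = 0"
    by (intro sum.neutral ballI j(1)) (use n in auto)
  also have "?T = 0"
    by (intro sum.neutral ballI j(1)) (use n in auto)
  also have "0 + 0 = (0 :: complex)"
    by simp
  finally show "frob m n (mat_comm (mat_comm a b) c) + frob m n (mat_comm (mat_comm b c) a)
    + frob m n (mat_comm (mat_comm c a) b) = 0" .
  have "(\<Sum>k=1..m. ent (mat_comm (mat_comm b a) c) k (n - k + 1)) =
      (\<Sum>k=1..m. - ent (mat_comm (mat_comm a b) c) k (n - k + 1))"
    by (intro sum.cong refl j(2)) (use n in auto)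
  moreover have "(\<Sum>l=1..m. ent (mat_comm (mat_comm b a) c) (2 * l) (2 * l - 1)) =
      (\<Sum>l=1..m. - ent (mat_comm (mat_comm a b) c) (2 * l) (2 * l - 1))"
    by (intro sum.cong refl j(2)) (use n in auto)
  ultimately show "frob m n (mat_comm (mat_comm b a) c) = - frob m n (mat_comm (mat_comm a b) c)"
    by (simp add: frob_def sum_negf)
qed

lemma frob_add_right:
  assumes n: "n = 2 * m + 1" and abc: "x \<in> carrier_mat n n" "a \<in> carrier_mat n n" "b \<in> carrier_mat n n"
  shows "frob m n (mat_comm x (a + b)) = frob m n (mat_comm x a) + frob m n (mat_comm x b)"
proof -
  have j: "ent (mat_comm x (a + b)) i j = ent (mat_comm x a) i j + ent (mat_comm x b) i j"
    if "1 \<le> i" "i \<le> n" "1 \<le> j" "j \<le> n" for i j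
    using that abc by (simp add: ent_mat_comm ent_add[of _ n] algebra_simps sum.distrib)
  have "(\<Sum>k=1..m. ent (mat_comm x (a + b)) k (n - k + 1)) =
      (\<Sum>k=1..m. ent (mat_comm x a) k (n - k + 1) + ent (mat_comm x b) k (n - k + 1))"
    by (intro sum.cong refl j) (use n in auto)
  moreover have "(\<Sum>l=1..m. ent (mat_comm x (a + b)) (2 * l) (2 * l - 1)) =
      (\<Sum>l=1..m. ent (mat_comm x a) (2 * l) (2 * l - 1) + ent (mat_comm x b) (2 * l) (2 * l - 1))"
    by (intro sum.cong refl j) (use n in auto)
  ultimately show ?thesis
    by (simp add: frob_def sum.distrib)
qed

section \<open>Values of the form on matrix units\<close>

lemma sum_unique:
  assumes "finite A" "\<And>k. k \<in> A \<Longrightarrow> P k \<longleftrightarrow> Q \<and> k = k0" "Q \<Longrightarrow> k0 \<in> A"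
  shows "(\<Sum>k\<in>A. if P k then g k else 0) = (if Q then g k0 else 0)"
proof -
  have "(\<Sum>k\<in>A. if P k then g k else 0) = (\<Sum>k\<in>A. if k = k0 then (if Q then g k else 0) else 0)"
    by (rule sum.cong) (auto simp: assms(2))
  then show ?thesis using assms(1,3) by auto
qed

text \<open>The bracket carries column \<open>a\<close> of \<open>x\<close> into column
  \<open>b\<close> and subtracts row \<open>b\<close> of \<open>x\<close> in row \<open>a\<close>.
  The functional meets column \<open>b\<close> only at (n - b + 1, b) and (b + 1, b), and row
  \<open>a\<close> only at (a, n - a + 1) and (a, a - 1); the side conditions say when these
  positions occur.\<close>

lemma frob_mat_comm_E:
  assumes n: "n = 2 * m + 1" and x: "x \<in> carrier_mat n n" and ab: "1 \<le> a" "a \<le> n" "1 \<le> b" "b \<le> n"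
  shows "frob m n (mat_comm x (E n a b)) =
    (if m + 2 \<le> b then ent x (n - b + 1) a else 0) - (if a \<le> m then ent x b (n - a + 1) else 0)
    + (if odd b \<and> b < n then ent x (b + 1) a else 0) - (if even a then ent x b (a - 1) else 0)"
proof -
  have "(\<Sum>k=1..m. ent (mat_comm x (E n a b)) k (n - k + 1)) =
      (\<Sum>k=1..m. if n - k + 1 = b then ent x k a else 0)
      - (\<Sum>k=1..m. if k = a then ent x b (n - k + 1) else 0)"
    unfolding sum_subtractf[symmetric]
    by (intro sum.cong refl ent_mat_comm_E[OF x ab]) (use n in auto)
  moreover have "(\<Sum>l=1..m. ent (mat_comm x (E n a b)) (2 * l) (2 * l - 1)) =
      (\<Sum>l=1..m. if 2 * l - 1 = b then ent x (2 * l) a else 0)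
      - (\<Sum>l=1..m. if 2 * l = a then ent x b (2 * l - 1) else 0)"
    unfolding sum_subtractf[symmetric]
    by (intro sum.cong refl ent_mat_comm_E[OF x ab]) (use n in auto)
  moreover have "(\<Sum>k=1..m. if n - k + 1 = b then ent x k a else 0) =
      (if m + 2 \<le> b then ent x (n - b + 1) a else 0)"
    by (rule sum_unique) (use n ab in auto)
  moreover have "(\<Sum>k=1..m. if k = a then ent x b (n - k + 1) else 0) =
      (if a \<le> m then ent x b (n - a + 1) else 0)"
    by (rule sum_unique) (use n ab in auto)
  moreover have "(\<Sum>l=1..m. if 2 * l - 1 = b then ent x (2 * l) a else 0) =
      (if odd b \<and> b < n then ent x (2 * ((b + 1) div 2)) a else 0)"
    by (rule sum_unique) (use n ab in \<open>auto elim!: oddE\<close>)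
  moreover have "(\<Sum>l=1..m. if 2 * l = a then ent x b (2 * l - 1) else 0) =
      (if even a then ent x b (2 * (a div 2) - 1) else 0)"
    by (rule sum_unique) (use n ab in \<open>auto elim!: evenE\<close>)
  ultimately show ?thesis
    by (simp add: frob_def)
qed

lemma double_p0: "2 * p0 m = (if odd m then m + 1 else m + 2)"
  by (auto simp: p0_def elim!: oddE evenE)

text \<open>The two units contribute the same entries of \<open>x\<close>, at (2k - 1, n - 2k + 1)
  or (n - 2k + 2, 2k), with opposite signs, which is why \<open>Ehat\<close> has a second summand.
  The ranges differ only for 2k = m + 1 or m + 2, that is for k = \<open>p0 m\<close>, where the
  first unit alone gives \<open>alpha k\<close>.\<close>

lemma frob_mat_comm_Ehat:
  assumes n: "n = 2 * m + 1" and x: "x \<in> par n" and k: "1 \<le> k" "k \<le> m"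
  shows "frob m n (mat_comm x (Ehat m n k)) = alpha k x"
proof -
  note c = parD(2)[OF x]
  have 1: "frob m n (mat_comm x (E n (2 * k) (2 * k - 1))) =
     (if m + 3 \<le> 2 * k then ent x (n - 2 * k + 2) (2 * k) else 0)
     - (if 2 * k \<le> m then ent x (2 * k - 1) (n - 2 * k + 1) else 0) + alpha k x"
  proof -
    have "m + 2 \<le> 2 * k - 1 \<longleftrightarrow> m + 3 \<le> 2 * k" "n - (2 * k - 1) + 1 = n - 2 * k + 2"
      "odd (2 * k - 1)" "2 * k - 1 < n" "2 * k - 1 + 1 = 2 * k"
      using n k by auto
    then show ?thesis
      using frob_mat_comm_E[OF n c, of "2 * k" "2 * k - 1"] n k by (simp add: alpha_def)
  qed
  have 2: "frob m n (mat_comm x (E n (n - 2 * k + 1) (n - 2 * k + 2))) =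
     (if 2 * k \<le> m + 1 then ent x (2 * k - 1) (n - 2 * k + 1) else 0)
     - (if m + 2 \<le> 2 * k then ent x (n - 2 * k + 2) (2 * k) else 0)"
  proof -
    have e: "m + 2 \<le> n - 2 * k + 2 \<longleftrightarrow> 2 * k \<le> m + 1" "n - 2 * k + 1 \<le> m \<longleftrightarrow> m + 2 \<le> 2 * k"
      "n - (n - 2 * k + 2) + 1 = 2 * k - 1" "n - (n - 2 * k + 1) + 1 = 2 * k"
      using n k by auto
    \<comment> \<open>This entry and the next one lie two places below the diagonal, outside the
      parabolic pattern.\<close>
    have "ent x (n - 2 * k + 2 + 1) (n - 2 * k + 1) = 0" if "n - 2 * k + 2 < n"
      by (rule parD(3)[OF x]) (use that n k in \<open>auto simp: allowed_def\<close>)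
    moreover have "ent x (n - 2 * k + 2) (n - 2 * k + 1 - 1) = 0"
      by (rule parD(3)[OF x]) (use n k in \<open>auto simp: allowed_def\<close>)
    ultimately show ?thesis
      using frob_mat_comm_E[OF n c, of "n - 2 * k + 1" "n - 2 * k + 2", unfolded e] n k by auto
  qed
  show ?thesis
  proof (cases "k = p0 m")
    case True
    then have "\<not> m + 3 \<le> 2 * k" "\<not> 2 * k \<le> m"
      using double_p0[of m] by (auto split: if_splits)
    then show ?thesis using True 1 by (simp add: Ehat_def)
  next
    case False
    have "2 * k \<noteq> m + 1" "2 * k \<noteq> m + 2"
      using False double_p0[of m] by (auto split: if_splits)
    then have "m + 2 \<le> 2 * k \<longleftrightarrow> m + 3 \<le> 2 * k" "2 * k \<le> m + 1 \<longleftrightarrow> 2 * k \<le> m"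
      by auto
    then show ?thesis
      using False 1 2 frob_add_right[OF n c E_carrier E_carrier] by (simp add: Ehat_def)
  qed
qed

text \<open>The two antidiagonal contributions of \<open>frob_mat_comm_E\<close> give
  \<open>theta\<close>; the other two sit far below the diagonal, where elements of
  \<open>par n\<close> vanish.\<close>

lemma frob_mat_comm_antidiag:
  assumes n: "n = 2 * m + 1" and x: "x \<in> par n" and k: "1 \<le> k" "k \<le> m"
  shows "frob m n (mat_comm x (E n k (n - k + 1))) = theta n k x"
proof -
  have e: "m + 2 \<le> n - k + 1" "n - (n - k + 1) + 1 = k" using n k by auto
  have "ent x (n - k + 1 + 1) k = 0" if "n - k + 1 < n"
    by (rule parD(3)[OF x]) (use that n k in \<open>auto simp: allowed_def\<close>)
  moreover have "ent x (n - k + 1) (k - 1) = 0" if "even k"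
    by (rule parD(3)[OF x]) (use that n k in \<open>auto simp: allowed_def elim!: evenE\<close>)
  ultimately show ?thesis
    using frob_mat_comm_E[OF n parD(2)[OF x], of k "n - k + 1", unfolded e] e(1) n k
    by (auto simp: theta_ent)
qed

text \<open>Apart from the pairing with \<open>E n p (n - k + 1)\<close> there is a correction: for
  p = n - k the antidiagonal entry of column \<open>p\<close> is in row k + 1, and (k + 1, k) is an
  allowed position when \<open>k\<close> is odd.\<close>

lemma frob_mat_comm_lower:
  assumes n: "n = 2 * m + 1" and x: "x \<in> par n" and k: "1 \<le> k" "k \<le> m" "k < p" "p \<le> n - k"
  shows "frob m n (mat_comm x (E n k p)) =
    (if p = n - k \<and> odd k \<and> k < m then ent x (k + 1) k else 0) - ent x p (n - k + 1)"
proof -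
  have "ent x (p + 1) k = 0" if "p < n"
    by (rule parD(3)[OF x]) (use that n k in \<open>auto simp: allowed_def\<close>)
  moreover have "ent x p (k - 1) = 0" if "even k"
    by (rule parD(3)[OF x]) (use that n k in \<open>auto simp: allowed_def elim!: evenE\<close>)
  moreover have "(if m + 2 \<le> p then ent x (n - p + 1) k else 0) =
      (if p = n - k \<and> odd k \<and> k < m then ent x (k + 1) k else 0)"
  proof (cases "p = n - k \<and> odd k")
    case True
    then show ?thesis using n k by auto
  next
    case False
    have "ent x (n - p + 1) k = 0"
      by (rule parD(3)[OF x]) (use n k False in \<open>auto simp: allowed_def\<close>)
    then show ?thesis using False by auto
  qed
  ultimately show ?thesis
    using frob_mat_comm_E[OF n parD(2)[OF x], of k p] n k by auto
qed

text \<open>The mirror image: for p = k + 1 row \<open>p\<close> meets the antidiagonal in column n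
  - k, and (n - k + 1, n - k) is an allowed subdiagonal position when \<open>k\<close> is even,
  because \<open>n\<close> is odd.\<close>

lemma frob_mat_comm_upper:
  assumes n: "n = 2 * m + 1" and x: "x \<in> par n" and k: "1 \<le> k" "k \<le> m" "k < p" "p \<le> n - k"
  shows "frob m n (mat_comm x (E n p (n - k + 1))) =
    ent x k p - (if p = k + 1 \<and> even k \<and> k < m then ent x (n - k + 1) (n - k) else 0)"
proof -
  have e: "m + 2 \<le> n - k + 1" "n - (n - k + 1) + 1 = k" using n k by auto
  have "ent x (n - k + 1 + 1) p = 0" if "n - k + 1 < n"
    by (rule parD(3)[OF x]) (use that n k in \<open>auto simp: allowed_def\<close>)
  moreover have "ent x (n - k + 1) (p - 1) = 0"
    by (rule parD(3)[OF x]) (use n k in \<open>auto simp: allowed_def\<close>)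
  moreover have "(if p \<le> m then ent x (n - k + 1) (n - p + 1) else 0) =
      (if p = k + 1 \<and> even k \<and> k < m then ent x (n - k + 1) (n - k) else 0)"
  proof (cases "p = k + 1 \<and> even k")
    case True
    have "n - (k + 1) + 1 = n - k" using n k by auto
    with True show ?thesis by auto
  next
    case False
    have "ent x (n - k + 1) (n - p + 1) = 0" if "p \<le> m"
      by (rule parD(3)[OF x]) (use that n k False in \<open>auto simp: allowed_def\<close>)
    then show ?thesis using False by auto
  qed
  ultimately show ?thesis
    using frob_mat_comm_E[OF n parD(2)[OF x], of p "n - k + 1", unfolded e] e(1) n k by auto
qed

section \<open>Reproducing property\<close>

text \<open>The extra assumption makes the families \<open>Hp\<close>, \<open>Hh\<close> the basis
  of the Cartan subalgebra dual to \<open>alpha\<close>, \<open>theta\<close>. By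
  \<open>alpha_Hh_of_CYBE\<close> it is also necessary for the Yang-Baxter equation.\<close>

locale frobenius_chain = enlarged_chain +
  assumes alpha_Hh: "\<And>l k. l \<in> {1..m} \<Longrightarrow> k \<in> {1..m} \<Longrightarrow> alpha l (Hh k) = 0"
begin

lemma cartan_par: "h \<in> cartan n \<Longrightarrow> h \<in> par n"
  using cartanD by (auto simp: par_def allowed_def)

lemma Ehat_par: "k \<in> {1..m} \<Longrightarrow> Ehat m n k \<in> par n"
  using sl_Ehat n_bounds by (auto simp: par_def allowed_def ent_Ehat)

lemma E_par: "1 \<le> i \<Longrightarrow> i < j \<Longrightarrow> E n i j \<in> par n"
  by (auto simp: par_def allowed_def ent_E sl_E)

lemma gen_par: "b \<in> idx \<Longrightarrow> gen b \<in> par n"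
  by (erule gen_cases)
    (use n_bounds in \<open>auto simp: cartan_par[OF Hp] cartan_par[OF Hh] Ehat_par E_par\<close>)

text \<open>The difference of both sides, as a function of \<open>i\<close>, has trace 0 and
  vanishing \<open>theta\<close> and \<open>alpha\<close> by duality, so
  \<open>diagonal_separation\<close> applies.\<close>

lemma cartan_expansion:
  assumes x: "x \<in> sl n" and i: "1 \<le> i" "i \<le> n"
  shows "ent x i i = (\<Sum>k=1..m. alpha k x * ent (Hp k) i i + theta n k x * ent (Hh k) i i)"
proof -
  define d where
    "d i = ent x i i - (\<Sum>k=1..m. alpha k x * ent (Hp k) i i + theta n k x * ent (Hh k) i i)" for i
  have dd: "d i - d j = ent x i i - ent x j j - (\<Sum>k=1..m. alpha k x * (ent (Hp k) i i - ent (Hp k) j j)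
      + theta n k x * (ent (Hh k) i i - ent (Hh k) j j))" for i j
    unfolding d_def by (simp add: algebra_simps sum.distrib sum_subtractf)
  have "d i = 0"
  proof (rule diagonal_separation[OF n _ _ _ i])
    have "(\<Sum>i=1..n. \<Sum>k=1..m. alpha k x * ent (Hp k) i i + theta n k x * ent (Hh k) i i) =
      (\<Sum>k=1..m. \<Sum>i=1..n. alpha k x * ent (Hp k) i i + theta n k x * ent (Hh k) i i)"
      by (rule sum.swap)
    also have "\<dots> = (\<Sum>k=1..m. alpha k x * (\<Sum>i=1..n. ent (Hp k) i i)
        + theta n k x * (\<Sum>i=1..n. ent (Hh k) i i))"
      by (simp only: sum.distrib sum_distrib_left)
    also have "\<dots> = 0"
      by (intro sum.neutral ballI) (simp only: cartanD(3)[OF Hp] cartanD(3)[OF Hh] mult_zero_right add_0)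
    finally show "(\<Sum>i=1..n. d i) = 0"
      using x by (simp only: d_def sum_subtractf sl_iff diff_self)
  next
    fix j assume j: "j \<in> {1..m}"
    have t: "theta n j A = ent A j j - ent A (n - j + 1) (n - j + 1)" for A
      using j n_bounds by (intro theta_ent) auto
    have "d j - d (n - j + 1) = theta n j x - (\<Sum>k=1..m. alpha k x * theta n j (Hp k)
        + theta n k x * theta n j (Hh k))"
      unfolding dd t[symmetric] ..
    also have "(\<Sum>k=1..m. alpha k x * theta n j (Hp k) + theta n k x * theta n j (Hh k)) =
        (\<Sum>k=1..m. if k = j then theta n k x else 0)"
      by (intro sum.cong refl) (auto simp: theta_Hp[OF j] theta_Hh[OF j])
    finally show "d j = d (n - j + 1)" using j by simp
    have "d (2 * j) - d (2 * j - 1) = alpha j x - (\<Sum>k=1..m. alpha k x * alpha j (Hp k)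
        + theta n k x * alpha j (Hh k))"
      unfolding dd alpha_def[symmetric] ..
    also have "(\<Sum>k=1..m. alpha k x * alpha j (Hp k) + theta n k x * alpha j (Hh k)) =
        (\<Sum>k=1..m. if k = j then alpha k x else 0)"
      by (intro sum.cong refl) (auto simp: alpha_Hp[OF j] alpha_Hh[OF j])
    finally show "d (2 * j) = d (2 * j - 1)" using j by simp
  qed
  then show ?thesis by (simp add: d_def)
qed

lemma frob_mat_comm_diag:
  assumes x: "x \<in> par n" and h: "h \<in> cartan n"
  shows "frob m n (mat_comm x h) =
    - (\<Sum>k=1..m. theta n k h * ent x k (n - k + 1)) - (\<Sum>l=1..m. alpha l h * ent x (2 * l) (2 * l - 1))"
proof -
  have "(\<Sum>k=1..m. ent (mat_comm x h) k (n - k + 1)) = (\<Sum>k=1..m. - (theta n k h * ent x k (n - k + 1)))"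
  proof (rule sum.cong[OF refl])
    fix k assume k: "k \<in> {1..m}"
    then have "n - k + 1 \<le> n" "1 \<le> n - k + 1"
      using n_bounds by auto
    then show "ent (mat_comm x h) k (n - k + 1) = - (theta n k h * ent x k (n - k + 1))"
      using k
      using ent_mat_comm_diag(2)[OF h parD(2)[OF x], of k "n - k + 1"] n_bounds
      by (simp add: theta_ent algebra_simps)
  qed
  moreover have "(\<Sum>l=1..m. ent (mat_comm x h) (2 * l) (2 * l - 1)) =
      (\<Sum>l=1..m. - (alpha l h * ent x (2 * l) (2 * l - 1)))"
  proof (rule sum.cong[OF refl])
    fix l assume l: "l \<in> {1..m}"
    then have "1 \<le> 2 * l" "2 * l \<le> n" "1 \<le> 2 * l - 1" "2 * l - 1 \<le> n"
      using n_bounds by auto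
    then show "ent (mat_comm x h) (2 * l) (2 * l - 1) = - (alpha l h * ent x (2 * l) (2 * l - 1))"
      using ent_mat_comm_diag(2)[OF h parD(2)[OF x], of "2 * l" "2 * l - 1"] n_bounds
      by (simp add: alpha_def algebra_simps)
  qed
  ultimately show ?thesis
    by (simp add: frob_def sum_negf)
qed

lemma frob_mat_comm_Hp:
  assumes "x \<in> par n" "k \<in> {1..m}"
  shows "frob m n (mat_comm x (Hp k)) = - ent x (2 * k) (2 * k - 1)"
proof -
  have "(\<Sum>l=1..m. alpha l (Hp k) * ent x (2 * l) (2 * l - 1)) =
      (\<Sum>l=1..m. if l = k then ent x (2 * l) (2 * l - 1) else 0)"
    using assms(2) by (intro sum.cong refl) (simp add: alpha_Hp)
  moreover have "(\<Sum>j=1..m. theta n j (Hp k) * ent x j (n - j + 1)) = 0"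
    using assms(2) by (intro sum.neutral) (simp add: theta_Hp)
  ultimately show ?thesis
    using frob_mat_comm_diag[OF assms(1) Hp[OF assms(2)]] assms(2) by simp
qed

lemma frob_mat_comm_Hh:
  assumes "x \<in> par n" "k \<in> {1..m}"
  shows "frob m n (mat_comm x (Hh k)) = - ent x k (n - k + 1)"
proof -
  have "(\<Sum>j=1..m. theta n j (Hh k) * ent x j (n - j + 1)) =
      (\<Sum>j=1..m. if j = k then ent x j (n - j + 1) else 0)"
    using assms(2) by (intro sum.cong refl) (simp add: theta_Hh)
  moreover have "(\<Sum>l=1..m. alpha l (Hh k) * ent x (2 * l) (2 * l - 1)) = 0"
    using assms(2) by (intro sum.neutral) (simp add: alpha_Hh)
  ultimately show ?thesis
    using frob_mat_comm_diag[OF assms(1) Hh[OF assms(2)]] assms(2) by simp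
qed

text \<open>Positions above the diagonal are split by comparing i + j with n + 1: the left chain
  factors fill the side i + j < n + 1, the units \<open>E n k (n - k + 1)\<close> the antidiagonal,
  and the right chain factors the rest. Each position is hit once, so the sums here and in the next
  two lemmas collapse.\<close>

lemma double_sum_lower:
  assumes ij: "1 \<le> i" "i \<le> n" "1 \<le> j" "j \<le> n"
  shows "(\<Sum>k=1..m. \<Sum>p=k+1..n-k. g k p * ent (E n k p) i j) =
    (if i < j \<and> i + j < n + 1 then g i j else 0)"
proof -
  have "(\<Sum>k=1..m. \<Sum>p=k+1..n-k. g k p * ent (E n k p) i j) =
      (\<Sum>k=1..m. \<Sum>p=k+1..n-k. if k = i \<and> p = j then g k p else 0)"
    using ij by (intro sum.cong refl) (auto simp: ent_E)
  also have "\<dots> = (if i \<in> {1..m} \<and> j \<in> {i+1..n-i} then g i j else 0)"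
    by (rule sum_sum_delta) auto
  also have "i \<in> {1..m} \<and> j \<in> {i+1..n-i} \<longleftrightarrow> i < j \<and> i + j < n + 1"
    using ij n_bounds by auto
  finally show ?thesis .
qed

lemma double_sum_upper:
  assumes ij: "1 \<le> i" "i \<le> n" "1 \<le> j" "j \<le> n"
  shows "(\<Sum>k=1..m. \<Sum>p=k+1..n-k. g k p * ent (E n p (n - k + 1)) i j) =
    (if i < j \<and> n + 1 < i + j then g (n - j + 1) i else 0)"
proof -
  have "(\<Sum>k=1..m. \<Sum>p=k+1..n-k. g k p * ent (E n p (n - k + 1)) i j) =
      (\<Sum>k=1..m. \<Sum>p=k+1..n-k. if k = n - j + 1 \<and> p = i then g k p else 0)"
    using ij n_bounds by (intro sum.cong refl) (auto simp: ent_E)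
  also have "\<dots> = (if n - j + 1 \<in> {1..m} \<and> i \<in> {(n-j+1)+1..n-(n-j+1)} then g (n - j + 1) i else 0)"
    by (rule sum_sum_delta) auto
  also have "n - j + 1 \<in> {1..m} \<and> i \<in> {(n-j+1)+1..n-(n-j+1)} \<longleftrightarrow> i < j \<and> n + 1 < i + j"
    using ij n_bounds by auto
  finally show ?thesis .
qed

lemma sum_antidiag:
  assumes ij: "1 \<le> i" "i \<le> n" "1 \<le> j" "j \<le> n"
  shows "(\<Sum>k=1..m. g k * ent (E n k (n - k + 1)) i j) =
    (if i < j \<and> i + j = n + 1 then g i else 0)"
proof -
  have "(\<Sum>k=1..m. g k * ent (E n k (n - k + 1)) i j) =
      (\<Sum>k=1..m. if i = k \<and> j = n - k + 1 then g k else 0)"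
    using ij by (intro sum.cong refl) (simp add: ent_E)
  also have "\<dots> = (if i < j \<and> i + j = n + 1 then g i else 0)"
    by (rule sum_unique) (use ij n in auto)
  finally show ?thesis .
qed

text \<open>A superdiagonal position (i, i + 1) with \<open>i\<close> even comes from the
  \<open>k\<close> with 2k = n - i + 1. The excluded index \<open>p0 m\<close> corresponds to i = m
  or i = m + 1, whichever is even.\<close>

lemma sum_Ehat:
  assumes ij: "1 \<le> i" "i \<le> n" "1 \<le> j" "j \<le> n"
  shows "(\<Sum>k=1..m. ent x (2 * k) (2 * k - 1) * ent (Ehat m n k) i j) =
    (if even i \<and> i = j + 1 then ent x i j else 0) +
    (if even i \<and> j = i + 1 \<and> i \<noteq> m \<and> i \<noteq> m + 1 then ent x (n - i + 1) (n - i) else 0)"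
proof -
  have even_i: "even (n - i + 1) \<longleftrightarrow> even i"
    using ij n by simp
  have "(\<Sum>k=1..m. ent x (2 * k) (2 * k - 1) * ent (Ehat m n k) i j) =
      (\<Sum>k=1..m. if i = 2 * k \<and> j = 2 * k - 1 then ent x (2 * k) (2 * k - 1) else 0) +
      (\<Sum>k=1..m. if k \<noteq> p0 m \<and> i = n - 2 * k + 1 \<and> j = n - 2 * k + 2
        then ent x (2 * k) (2 * k - 1) else 0)"
    unfolding sum.distrib[symmetric]
    by (intro sum.cong refl) (simp add: ent_Ehat[OF ij] distrib_left)
  also have "(\<Sum>k=1..m. if i = 2 * k \<and> j = 2 * k - 1 then ent x (2 * k) (2 * k - 1) else 0) =
      (if even i \<and> i = j + 1 then ent x (2 * (i div 2)) (2 * (i div 2) - 1) else 0)"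
  proof (rule sum_unique)
    fix k assume "k \<in> {1..m}"
    moreover have "even i \<and> k = i div 2 \<longleftrightarrow> i = 2 * k"
      by auto
    ultimately show "(i = 2 * k \<and> j = 2 * k - 1) \<longleftrightarrow> (even i \<and> i = j + 1) \<and> k = i div 2"
      using ij by auto
  qed (use ij n in auto)
  also have "\<dots> = (if even i \<and> i = j + 1 then ent x i j else 0)"
    by auto
  also have "(\<Sum>k=1..m. if k \<noteq> p0 m \<and> i = n - 2 * k + 1 \<and> j = n - 2 * k + 2
        then ent x (2 * k) (2 * k - 1) else 0) =
      (if even i \<and> j = i + 1 \<and> i \<noteq> m \<and> i \<noteq> m + 1
        then ent x (2 * ((n - i + 1) div 2)) (2 * ((n - i + 1) div 2) - 1) else 0)"
  proof (rule sum_unique)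
    fix k assume k: "k \<in> {1..m}"
    have p0: "k \<noteq> p0 m \<longleftrightarrow> 2 * k \<noteq> 2 * p0 m" by simp
    have ev: "even (n - 2 * k + 1)" using k n by simp
    have "k \<noteq> p0 m \<longleftrightarrow> n - 2 * k + 1 \<noteq> m \<and> n - 2 * k + 1 \<noteq> m + 1"
    proof (cases "odd m")
      case True
      have "n - 2 * k + 1 = m + 1 \<longleftrightarrow> 2 * k = m + 1" using k n by auto
      moreover have "n - 2 * k + 1 \<noteq> m" using ev True by metis
      ultimately show ?thesis unfolding p0 double_p0 using True by simp
    next
      case False
      have "n - 2 * k + 1 = m \<longleftrightarrow> 2 * k = m + 2" using k n by auto
      moreover have "n - 2 * k + 1 \<noteq> m + 1" using ev False by (metis even_plus_one_iff)
      ultimately show ?thesis unfolding p0 double_p0 using False by simp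
    qed
    moreover have "n - 2 * k + 1 = i \<longleftrightarrow> even i \<and> k = (n - i + 1) div 2"
    proof -
      have "even a \<and> k = a div 2 \<longleftrightarrow> a = 2 * k" for a :: nat
        by auto
      from this[of "n - i + 1"]
      have "even (n - i + 1) \<and> k = (n - i + 1) div 2 \<longleftrightarrow> n - i + 1 = 2 * k" .
      moreover have "n - i + 1 = 2 * k \<longleftrightarrow> n - 2 * k + 1 = i"
        using k n ij by auto
      ultimately show ?thesis using even_i by blast
    qed
    ultimately show "(k \<noteq> p0 m \<and> i = n - 2 * k + 1 \<and> j = n - 2 * k + 2) \<longleftrightarrow>
        (even i \<and> j = i + 1 \<and> i \<noteq> m \<and> i \<noteq> m + 1) \<and> k = (n - i + 1) div 2"
      by auto
  next
    assume *: "even i \<and> j = i + 1 \<and> i \<noteq> m \<and> i \<noteq> m + 1"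
    then have "i \<noteq> 1" by auto
    then have "2 \<le> n - i + 1" "n - i + 1 \<le> 2 * m"
      using * ij n by auto
    then show "(n - i + 1) div 2 \<in> {1..m}"
      by (simp add: div_le_mono[of "n - i + 1" "2 * m" 2, simplified])
  qed simp
  also have "\<dots> = (if even i \<and> j = i + 1 \<and> i \<noteq> m \<and> i \<noteq> m + 1 then ent x (n - i + 1) (n - i) else 0)"
  proof (cases "even i")
    case True
    then have "2 * ((n - i + 1) div 2) = n - i + 1"
      using even_i by (simp only: dvd_mult_div_cancel)
    then show ?thesis by simp
  qed simp
  finally show ?thesis .
qed

text \<open>The corrections in \<open>frob_mat_comm_lower\<close> and
  \<open>frob_mat_comm_upper\<close> land on superdiagonal positions (i, i + 1) with
  \<open>i\<close> even and cancel the second summands of the \<open>Ehat\<close>; the rest is read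
  off position by position. The identity expresses that \<open>r_ech\<close> is inverse to the form
  f([x, y]) on \<open>par n\<close>.\<close>

lemma frobenius_reproducing:
  assumes x: "x \<in> par n" and ij: "1 \<le> i" "i \<le> n" "1 \<le> j" "j \<le> n"
  shows "ent x i j =
    (\<Sum>c\<in>idx. - (frob m n (mat_comm x (gen c)) * sgnb c) * ent (gen (flip c)) i j)"
proof -
  define w where "w k p = frob m n (mat_comm x (rgen k p)) * ent (lgen k p) i j
    - frob m n (mat_comm x (lgen k p)) * ent (rgen k p) i j" for k p
  define g1 where "g1 k p = ent x k p -
    (if p = k + 1 \<and> even k \<and> k < m then ent x (n - k + 1) (n - k) else 0)" for k p
  define g2 where "g2 k p = ent x p (n - k + 1) -
    (if p = n - k \<and> odd k \<and> k < m then ent x (k + 1) k else 0)" for k p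
  have inner: "(\<Sum>t\<in>UNIV. - (frob m n (mat_comm x (gen ((k, p), t))) * sgnb ((k, p), t)) *
      ent (gen (flip ((k, p), t))) i j) = w k p" for k p
    by (simp add: UNIV_bool gen_def flip_def sgnb_def w_def)
  have w0: "w k 0 = alpha k x * ent (Hp k) i j + ent x (2 * k) (2 * k - 1) * ent (Ehat m n k) i j"
    if "k \<in> {1..m}" for k
    using that frob_mat_comm_Ehat[OF n x, of k] frob_mat_comm_Hp[OF x that]
    by (simp add: w_def lgen_def rgen_def)
  have w1: "w k (n - k + 1) = theta n k x * ent (Hh k) i j
      + ent x k (n - k + 1) * ent (E n k (n - k + 1)) i j"
    if "k \<in> {1..m}" for k
    using that frob_mat_comm_antidiag[OF n x, of k] frob_mat_comm_Hh[OF x that]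
    by (simp add: w_def lgen_def rgen_def)
  have w2: "w k p = g1 k p * ent (E n k p) i j + g2 k p * ent (E n p (n - k + 1)) i j"
    if "k \<in> {1..m}" "p \<in> {k+1..n-k}" for k p
  proof -
    have kp: "1 \<le> k" "k \<le> m" "k < p" "p \<le> n - k" "p \<noteq> 0" "p \<noteq> n - k + 1"
      using that by auto
    have f: "frob m n (mat_comm x (E n p (n - k + 1))) = g1 k p"
      "frob m n (mat_comm x (E n k p)) = - g2 k p"
      unfolding g1_def g2_def frob_mat_comm_upper[OF n x kp(1-4)] frob_mat_comm_lower[OF n x kp(1-4)]
      by simp_all
    have lr: "lgen k p = E n k p" "rgen k p = E n p (n - k + 1)"
      using kp(5,6) by (simp_all add: lgen_def rgen_def)
    show ?thesis
      unfolding w_def lr f by simp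
  qed
  have "(\<Sum>c\<in>idx. - (frob m n (mat_comm x (gen c)) * sgnb c) * ent (gen (flip c)) i j) =
      (\<Sum>k=1..m. w k 0 + (w k (n - k + 1) + (\<Sum>p=k+1..n-k. w k p)))"
    unfolding sum_idx inner ..
  also have "\<dots> = (\<Sum>k=1..m.
      (alpha k x * ent (Hp k) i j + ent x (2 * k) (2 * k - 1) * ent (Ehat m n k) i j) +
      ((theta n k x * ent (Hh k) i j + ent x k (n - k + 1) * ent (E n k (n - k + 1)) i j) +
       (\<Sum>p=k+1..n-k. g1 k p * ent (E n k p) i j + g2 k p * ent (E n p (n - k + 1)) i j)))"
    by (intro sum.cong refl arg_cong2[of _ _ _ _ "(+)"] w0 w1 w2)
  also have "\<dots> = (\<Sum>k=1..m. alpha k x * ent (Hp k) i j + theta n k x * ent (Hh k) i j)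
      + (\<Sum>k=1..m. ent x (2 * k) (2 * k - 1) * ent (Ehat m n k) i j)
      + (\<Sum>k=1..m. ent x k (n - k + 1) * ent (E n k (n - k + 1)) i j)
      + (\<Sum>k=1..m. \<Sum>p=k+1..n-k. g1 k p * ent (E n k p) i j)
      + (\<Sum>k=1..m. \<Sum>p=k+1..n-k. g2 k p * ent (E n p (n - k + 1)) i j)"
    by (simp only: sum.distrib add_ac)
  also have "\<dots> = (\<Sum>k=1..m. alpha k x * ent (Hp k) i j + theta n k x * ent (Hh k) i j)
      + ((if even i \<and> i = j + 1 then ent x i j else 0) +
         (if even i \<and> j = i + 1 \<and> i \<noteq> m \<and> i \<noteq> m + 1 then ent x (n - i + 1) (n - i) else 0))
      + (if i < j \<and> i + j = n + 1 then ent x i (n - i + 1) else 0)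
      + (if i < j \<and> i + j < n + 1 then g1 i j else 0)
      + (if i < j \<and> n + 1 < i + j then g2 (n - j + 1) i else 0)"
    unfolding sum_Ehat[OF ij] sum_antidiag[OF ij] double_sum_lower[OF ij] double_sum_upper[OF ij] ..
  also have "\<dots> = ent x i j"
  proof (cases "i = j")
    case True
    then show ?thesis using cartan_expansion[OF parD(1)[OF x] ij(1,2)] by simp
  next
    case ne: False
    have 0: "(\<Sum>k=1..m. alpha k x * ent (Hp k) i j + theta n k x * ent (Hh k) i j) = 0"
      by (intro sum.neutral ballI)
        (simp only: cartanD(4)[OF Hp ij ne] cartanD(4)[OF Hh ij ne] mult_zero_right add_0)
    consider "j < i" | "i < j" "i + j < n + 1" | "i < j" "i + j = n + 1" | "i < j" "n + 1 < i + j"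
      using ne by linarith
    then show ?thesis
    proof cases
      case 1
      then show ?thesis
        using parD(3)[OF x ij] unfolding 0 by (auto simp: allowed_def)
    next
      case 2
      then have "i \<noteq> m + 1" "i < m \<longleftrightarrow> i \<noteq> m" if "j = i + 1"
        using that n by auto
      then show ?thesis
        using 2 unfolding 0 g1_def by auto
    next
      case 3
      \<comment> \<open>On the antidiagonal no superdiagonal term can interfere, since 2i + 1 = n +
        1 is impossible for odd \<open>n\<close>.\<close>
      then have "n - i + 1 = j" "\<not> (even i \<and> j = i + 1)"
        using n by auto presburger
      then show ?thesis
        using 3 unfolding 0 by auto
    next
      case 4
      have e: "n - (n - j + 1) + 1 = j" "i = n - (n - j + 1) \<longleftrightarrow> j = i + 1"
        using 4 ij by auto
      \<comment> \<open>With k = n - j + 1 the correction in \<open>g2\<close> is the entry (k + 1,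
        k) = (n - i + 1, n - i), which is the coefficient that the \<open>Ehat\<close> sum puts at
        this position.\<close>
      have "odd (n - j + 1) \<longleftrightarrow> even i" "n - j + 1 < m \<longleftrightarrow> i \<noteq> m \<and> i \<noteq> m + 1"
        "n - j + 1 + 1 = n - i + 1" "n - j + 1 = n - i" if "j = i + 1"
        using that 4 ij n by auto
      then show ?thesis
        using 4 unfolding 0 g2_def e by auto
    qed
  qed
  finally show ?thesis by (rule sym)
qed

lemma r_ech_solves_CYBE: "solves_CYBE (sl n) (r_ech m n Hp Hh)"
proof -
  define K where "K a b c = frob m n (mat_comm (mat_comm (gen a) (gen b)) (gen c))" for a b c
  have "cybe (\<Sum>b\<in>idx. Poly_Mapping.single (FWord [gen b], FWord [gen (flip b)]) (sgnb b))
      \<in> uea3_ideal (sl n)"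
  proof (rule cybe_in_ideal_of_structure_constants[where K = K])
    fix a b i j assume "a \<in> idx" "b \<in> idx" and ij: "i < n" "j < n"
    \<comment> \<open>Brackets of factors stay in \<open>par n\<close>, so the reproducing formula
      expands them with coefficients \<open>K a b c\<close>.\<close>
    then have "mat_comm (gen a) (gen b) \<in> par n"
      by (intro par_mat_comm gen_par)
    from frobenius_reproducing[OF this, of "Suc i" "Suc j"]
    show "mat_comm (gen a) (gen b) $$ (i, j) =
        (\<Sum>c\<in>idx. - (K a b c * sgnb c) * gen (flip c) $$ (i, j))"
      using ij by (simp add: K_def ent_def)
  next
    fix a b c assume abc: "a \<in> idx" "b \<in> idx" "c \<in> idx"
    show "K b a c = - K a b c" "K a b c + K b c a + K c a b = 0"
      using frob_jacobi[OF n gen_carrier[OF abc(1)] gen_carrier[OF abc(2)] gen_carrier[OF abc(3)]]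
      by (simp_all add: K_def)
  qed (simp_all add: finite_idx flip gen_sl)
  then show ?thesis
    by (simp add: solves_CYBE_def r_ech_eq cybe_def)
qed

end

section \<open>Existence and uniqueness\<close>

definition dmat :: "nat \<Rightarrow> (nat \<Rightarrow> complex) \<Rightarrow> complex mat" where
  "dmat n d = mat n n (\<lambda>(i, j). if i = j then d (Suc i) else 0)"

lemma ent_dmat: "1 \<le> i \<Longrightarrow> i \<le> n \<Longrightarrow> 1 \<le> j \<Longrightarrow> j \<le> n \<Longrightarrow>
    ent (dmat n d) i j = (if i = j then d i else 0)"
  by (auto simp: dmat_def ent_mat)

lemma cartan_dmat: "(\<Sum>i=1..n. d i) = 0 \<Longrightarrow> dmat n d \<in> cartan n"
  by (simp add: cartan_def sl_def dmat_def diagonal_mat_def sum.atLeast1_atMost_eq)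

lemma theta_dmat: "1 \<le> j \<Longrightarrow> j \<le> n \<Longrightarrow> theta n j (dmat n d) = d j - d (n - j + 1)"
  by (simp add: theta_ent ent_dmat)

lemma alpha_dmat: "1 \<le> l \<Longrightarrow> 2 * l \<le> n \<Longrightarrow> alpha l (dmat n d) = d (2 * l) - d (2 * l - 1)"
  by (simp add: alpha_def ent_dmat)

lemma theta_add: "A \<in> carrier_mat n n \<Longrightarrow> B \<in> carrier_mat n n \<Longrightarrow> 1 \<le> j \<Longrightarrow> j \<le> n \<Longrightarrow>
    theta n j (A + B) = theta n j A + theta n j B"
  by (simp add: theta_ent ent_add[of _ n])

lemma alpha_add: "A \<in> carrier_mat n n \<Longrightarrow> B \<in> carrier_mat n n \<Longrightarrow> 1 \<le> l \<Longrightarrow> 2 * l \<le> n \<Longrightarrow>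
    alpha l (A + B) = alpha l A + alpha l B"
  by (simp add: alpha_def ent_add[of _ n])

text \<open>
  Up to a scalar matrix, \<open>H\<^sub>k\<^sup>\<bottom>\<close> is the symmetric diagonal matrix whose entries jump by 1
  exactly from \<open>2k-1\<close> to \<open>2k\<close> and, symmetrically, from \<open>n-2k+2\<close> to \<open>n-2k+1\<close>.
\<close>

definition weight_perp :: "nat \<Rightarrow> nat \<Rightarrow> nat \<Rightarrow> complex" where
  "weight_perp n k i = (if 2 * k \<le> i then 1 else 0) + (if i + 2 * k \<le> n + 1 then 1 else 0)"

definition Hperp :: "nat \<Rightarrow> nat \<Rightarrow> complex mat" where
  "Hperp n k = dmat n (\<lambda>i. weight_perp n k i - (\<Sum>j=1..n. weight_perp n k j) / of_nat n)"

text \<open>The reflection i -> n - i + 1 exchanges the two indicators of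
  \<open>weight_perp\<close>, which gives \<open>theta\<close> = 0. The second indicator changes
  only between an even position and the next odd one, which no \<open>alpha l\<close> sees.
  Subtracting the mean corrects the trace.\<close>

lemma Hperp:
  assumes n: "n = 2 * m + 1" and k: "k \<in> {1..m}"
  shows "Hperp n k \<in> cartan n"
    and "j \<in> {1..m} \<Longrightarrow> theta n j (Hperp n k) = 0"
    and "l \<in> {1..m} \<Longrightarrow> alpha l (Hperp n k) = (if k = l then 1 else 0)"
proof -
  have "of_nat n \<noteq> (0 :: complex)" using n by (simp only: of_nat_eq_0_iff)
  then show "Hperp n k \<in> cartan n"
    unfolding Hperp_def by (intro cartan_dmat) (simp add: sum_subtractf)
  show "theta n j (Hperp n k) = 0" if j: "j \<in> {1..m}"
  proof -
    have "2 * k \<le> n - j + 1 \<longleftrightarrow> j + 2 * k \<le> n + 1" "n - j + 1 + 2 * k \<le> n + 1 \<longleftrightarrow> 2 * k \<le> j"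
      using j n by auto
    then have "weight_perp n k j = weight_perp n k (n - j + 1)"
      by (simp only: weight_perp_def add.commute)
    then show ?thesis
      using j n by (simp add: Hperp_def theta_dmat)
  qed
  show "alpha l (Hperp n k) = (if k = l then 1 else 0)" if l: "l \<in> {1..m}"
  proof -
    have "2 * k \<le> 2 * l \<longleftrightarrow> k \<le> l" "2 * k \<le> 2 * l - 1 \<longleftrightarrow> k < l"
      "2 * l + 2 * k \<le> n + 1 \<longleftrightarrow> l + k \<le> m + 1" "2 * l - 1 + 2 * k \<le> n + 1 \<longleftrightarrow> l + k \<le> m + 1"
      using l n by auto
    then have "weight_perp n k (2 * l) - weight_perp n k (2 * l - 1) = (if k = l then 1 else 0)"
      by (simp add: weight_perp_def)
    then show ?thesis
      using l n by (simp add: Hperp_def alpha_dmat)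
  qed
qed

lemma H_eq_dmat: "H n i j = dmat n (\<lambda>a. (if a = i then 1 / 2 else 0) - (if a = j then 1 / 2 else 0))"
  by (rule eq_matI) (auto simp: H_def E_def dmat_def)

lemma H_antidiag:
  assumes n: "n = 2 * m + 1" and k: "k \<in> {1..m}"
  shows "H n k (n - k + 1) \<in> cartan n"
    and "j \<in> {1..m} \<Longrightarrow> theta n j (H n k (n - k + 1)) = (if k = j then 1 else 0)"
  using k n by (auto simp: H_eq_dmat sum_subtractf theta_dmat intro!: cartan_dmat)

text \<open>The combination of the \<open>Hperp n l\<close> removes the \<open>alpha\<close>
  components of the canonical Cartan element and leaves its \<open>theta\<close> values
  unchanged.\<close>

definition Hhat :: "nat \<Rightarrow> nat \<Rightarrow> nat \<Rightarrow> complex mat" where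
  "Hhat m n k = H n k (n - k + 1) +
     dmat n (\<lambda>i. - (\<Sum>l=1..m. alpha l (H n k (n - k + 1)) * ent (Hperp n l) i i))"

lemma Hhat:
  assumes n: "n = 2 * m + 1" and k: "k \<in> {1..m}"
  shows "\<exists>X\<in>cartan_perp m n. Hhat m n k = H n k (n - k + 1) + X"
    and "l \<in> {1..m} \<Longrightarrow> alpha l (Hhat m n k) = 0"
proof -
  let ?H = "H n k (n - k + 1)"
  let ?d = "\<lambda>i. - (\<Sum>l=1..m. alpha l ?H * ent (Hperp n l) i i)"
  have "(\<Sum>i=1..n. \<Sum>l=1..m. alpha l ?H * ent (Hperp n l) i i) =
      (\<Sum>l=1..m. alpha l ?H * (\<Sum>i=1..n. ent (Hperp n l) i i))"
    by (subst sum.swap) (simp only: sum_distrib_left)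
  also have "\<dots> = 0"
    by (intro sum.neutral ballI) (simp only: cartanD(3)[OF Hperp(1)[OF n]] mult_zero_right)
  finally have X: "dmat n ?d \<in> cartan n"
    by (intro cartan_dmat) (simp only: sum_negf neg_equal_0_iff_equal)
  have "theta n j (dmat n ?d) = 0" if j: "j \<in> {1..m}" for j
  proof -
    have j': "1 \<le> j" "j \<le> n" using j n by auto
    have "theta n j (dmat n ?d) = - (\<Sum>l=1..m. alpha l ?H * theta n j (Hperp n l))"
      unfolding theta_dmat[OF j'] theta_ent[OF j'(2), of "Hperp n _"]
      by (simp add: right_diff_distrib sum_subtractf)
    also have "\<dots> = 0"
      using Hperp(2)[OF n _ j] by (simp add: sum.neutral)
    finally show ?thesis .
  qed
  with X show "\<exists>X\<in>cartan_perp m n. Hhat m n k = ?H + X"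
    by (auto simp: Hhat_def cartan_perp_def)
  show "alpha l (Hhat m n k) = 0" if l: "l \<in> {1..m}"
  proof -
    have l': "1 \<le> l" "2 * l \<le> n" using l n by auto
    have "alpha l (Hhat m n k) = alpha l ?H + alpha l (dmat n ?d)"
      unfolding Hhat_def
      by (rule alpha_add[OF cartanD(1)[OF H_antidiag(1)[OF n k]] cartanD(1)[OF X] l'])
    also have "alpha l (dmat n ?d) = - (\<Sum>j=1..m. alpha j ?H * alpha l (Hperp n j))"
      unfolding alpha_dmat[OF l'] alpha_def[of l "Hperp n _"]
      by (simp add: right_diff_distrib sum_subtractf)
    also have "(\<Sum>j=1..m. alpha j ?H * alpha l (Hperp n j)) = (\<Sum>j=1..m. if j = l then alpha j ?H else 0)"
      using Hperp(3)[OF n _ l] by (intro sum.cong refl) auto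
    finally show ?thesis using l by simp
  qed
qed

text \<open>The diagonal of \<open>h\<close> is symmetric under reflection, so both root vectors in
  \<open>Ehat m n l\<close> have weight \<open>alpha l h\<close> and their sum is an eigenvector of
  the bracket with \<open>h\<close>. The nonzero entry (2l, 2l - 1) recovers the eigenvalue.\<close>

lemma mat_comm_Ehat_iff:
  assumes n: "n = 2 * m + 1" and h: "h \<in> cartan_perp m n" and l: "l \<in> {1..m}"
  shows "mat_comm h (Ehat m n l) = (if P then Ehat m n l else 0\<^sub>m n n) \<longleftrightarrow>
    alpha l h = (if P then 1 else 0)"
proof -
  have hc: "h \<in> cartan n" using h by (simp add: cartan_perp_def)
  have sym: "ent h k k = ent h (n - k + 1) (n - k + 1)" if "1 \<le> k" "k \<le> n" for k
  proof -
    consider "k \<le> m" | "k = m + 1" | "m + 2 \<le> k" by linarith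
    then show ?thesis
    proof cases
      case 1
      then have "theta n k h = 0" using h that by (simp add: cartan_perp_def)
      then show ?thesis using that by (simp add: theta_ent)
    next
      case 2
      then show ?thesis using n by simp
    next
      case 3
      then have "n - (n - k + 1) + 1 = k" "n - k + 1 \<in> {1..m}" using that n by auto
      then have "theta n (n - k + 1) h = 0" using h by (simp add: cartan_perp_def)
      then show ?thesis using \<open>n - (n - k + 1) + 1 = k\<close> that by (simp add: theta_ent)
    qed
  qed
  have l': "1 \<le> 2 * l" "2 * l \<le> n" "1 \<le> 2 * l - 1" "2 * l - 1 \<le> n"
    using l n by auto
  have ent: "ent (mat_comm h (Ehat m n l)) i j = alpha l h * ent (Ehat m n l) i j"
    if ij: "1 \<le> i" "i \<le> n" "1 \<le> j" "j \<le> n" for i j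
  proof -
    have "n - 2 * l + 2 = n - (2 * l - 1) + 1" using l' by simp
    then have "ent h (n - 2 * l + 1) (n - 2 * l + 1) - ent h (n - 2 * l + 2) (n - 2 * l + 2) = alpha l h"
      using sym[OF l'(1,2)] sym[OF l'(3,4)] by (simp add: alpha_def)
    then show ?thesis
      unfolding ent_mat_comm_diag(1)[OF hc Ehat_carrier ij]
      by (auto simp: ent_Ehat[OF ij] alpha_def)
  qed
  show ?thesis
  proof
    assume "mat_comm h (Ehat m n l) = (if P then Ehat m n l else 0\<^sub>m n n)"
    then have "alpha l h * ent (Ehat m n l) (2 * l) (2 * l - 1) =
        (if P then 1 else 0) * ent (Ehat m n l) (2 * l) (2 * l - 1)"
      using ent[OF l'(1-4)] l' by (auto simp: ent_def)
    moreover have "ent (Ehat m n l) (2 * l) (2 * l - 1) \<noteq> 0"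
      unfolding ent_Ehat[OF l'(1-4)] by auto
    ultimately show "alpha l h = (if P then 1 else 0)" by simp
  next
    assume a: "alpha l h = (if P then 1 else 0)"
    show "mat_comm h (Ehat m n l) = (if P then Ehat m n l else 0\<^sub>m n n)"
    proof (rule eq_mat_entI[of _ n])
      fix i j assume ij: "1 \<le> i" "i \<le> n" "1 \<le> j" "j \<le> n"
      then have "ent (0\<^sub>m n n) i j = 0" by (simp add: ent_def)
      then show "ent (mat_comm h (Ehat m n l)) i j = ent (if P then Ehat m n l else 0\<^sub>m n n) i j"
        unfolding ent[OF ij] a by simp
    qed (use cartanD(1)[OF hc] in auto)
  qed
qed

lemma enlarged_chainI:
  assumes "1 \<le> m" and n: "n = 2 * m + 1"
    and Hp: "\<And>k. k \<in> {1..m} \<Longrightarrow> Hp k \<in> cartan_perp m n"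
      "\<And>k l. k \<in> {1..m} \<Longrightarrow> l \<in> {1..m} \<Longrightarrow> mat_comm (Hp k) (Ehat m n l) =
          (if k = l then Ehat m n l else 0\<^sub>m n n)"
    and Hh: "\<And>k. k \<in> {1..m} \<Longrightarrow> \<exists>X\<in>cartan_perp m n. Hh k = H n k (n - k + 1) + X"
  shows "enlarged_chain m n Hp Hh"
proof
  fix k assume k: "k \<in> {1..m}"
  then obtain X where X: "X \<in> cartan_perp m n" "Hh k = H n k (n - k + 1) + X"
    using Hh by blast
  have c: "X \<in> cartan n" "H n k (n - k + 1) \<in> cartan n"
    using X H_antidiag[OF n k] by (auto simp: cartan_perp_def)
  show "Hp k \<in> cartan n" using Hp(1)[OF k] by (simp add: cartan_perp_def)
  have "diagonal_mat (H n k (n - k + 1) + X)"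
    using c cartanD(1)[OF c(1)] cartanD(1)[OF c(2)] by (auto simp: cartan_def diagonal_mat_def)
  then show "Hh k \<in> cartan n"
    using c X(2) by (auto simp: cartan_def intro!: sl_add)
  fix j assume j: "j \<in> {1..m}"
  show "theta n j (Hp k) = 0" using Hp(1)[OF k] j by (simp add: cartan_perp_def)
  show "alpha j (Hp k) = (if k = j then 1 else 0)"
    using mat_comm_Ehat_iff[OF n Hp(1)[OF k] j] Hp(2)[OF k j] by blast
  have "theta n j (Hh k) = theta n j (H n k (n - k + 1)) + theta n j X"
    unfolding X(2) by (rule theta_add) (use cartanD(1)[OF c(1)] cartanD(1)[OF c(2)] j n in auto)
  then show "theta n j (Hh k) = (if k = j then 1 else 0)"
    using H_antidiag(2)[OF n k j] X(1) j by (simp add: cartan_perp_def)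
qed (use assms in auto)

text \<open>Conditions (i) and (ii) fix all coordinates of \<open>Hp k\<close> and the
  \<open>theta\<close> values of \<open>Hh k\<close>; the Yang-Baxter equation adds
  \<open>alpha\<close> = 0 by \<open>alpha_Hh_of_CYBE\<close>.\<close>

lemma enlarged_chain_unique:
  assumes "enlarged_chain m n Hp Hh" "enlarged_chain m n Hp' Hh'"
    and "solves_CYBE (sl n) (r_ech m n Hp Hh)" "solves_CYBE (sl n) (r_ech m n Hp' Hh')"
    and k: "k \<in> {1..m}"
  shows "Hp k = Hp' k" "Hh k = Hh' k"
proof -
  interpret A: enlarged_chain m n Hp Hh by fact
  interpret B: enlarged_chain m n Hp' Hh' by fact
  show "Hp k = Hp' k"
    by (rule cartan_eqI[OF A.n A.Hp[OF k] B.Hp[OF k]])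
      (simp_all only: A.theta_Hp[OF _ k] B.theta_Hp[OF _ k] A.alpha_Hp[OF _ k] B.alpha_Hp[OF _ k])
  show "Hh k = Hh' k"
    by (rule cartan_eqI[OF A.n A.Hh[OF k] B.Hh[OF k]])
      (simp_all only: A.theta_Hh[OF _ k] B.theta_Hh[OF _ k] A.alpha_Hh_of_CYBE[OF assms(3) k]
        B.alpha_Hh_of_CYBE[OF assms(4) k])
qed

theorem theorem2:
  fixes m n :: nat
  assumes "m \<ge> 1" and "n = 2 * m + 1"
  shows "\<exists>!F. F \<in> ({1..m} \<rightarrow>\<^sub>E cartan n) \<times> ({1..m} \<rightarrow>\<^sub>E cartan n) \<and>
    (case F of (Hp, Hh) \<Rightarrow>
      (\<forall>k\<in>{1..m}. Hp k \<in> cartan_perp m n \<and>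
        (\<forall>l\<in>{1..m}. mat_comm (Hp k) (Ehat m n l) =
          (if k = l then Ehat m n k else 0\<^sub>m n n))) \<and>
      (\<forall>k\<in>{1..m}. \<exists>X\<in>cartan_perp m n. Hh k = H n k (n - k + 1) + X) \<and>
      solves_CYBE (sl n) (r_ech m n Hp Hh))"
    (is "\<exists>!F. ?P F")
proof -
  have chain: "enlarged_chain m n Hp Hh \<and> solves_CYBE (sl n) (r_ech m n Hp Hh)" if "?P (Hp, Hh)" for Hp Hh
    using that by (auto intro!: enlarged_chainI[OF assms])
  \<comment> \<open>Families are extensional functions on \<open>{1..m}\<close>, so the witnesses
    are restricted: outside this set they take the fixed value \<open>undefined\<close>, which keeps
    uniqueness meaningful.\<close>
  define Hp where "Hp = restrict (Hperp n) {1..m}"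
  define Hh where "Hh = restrict (Hhat m n) {1..m}"
  have perp: "Hp k \<in> cartan_perp m n" if "k \<in> {1..m}" for k
    using that Hperp[OF assms(2) that] by (simp add: Hp_def cartan_perp_def)
  have comm: "mat_comm (Hp k) (Ehat m n l) = (if k = l then Ehat m n l else 0\<^sub>m n n)"
    if "k \<in> {1..m}" "l \<in> {1..m}" for k l
    using mat_comm_Ehat_iff[OF assms(2) perp[OF that(1)] that(2)] Hperp(3)[OF assms(2) that] that(1)
    by (simp add: Hp_def)
  have hat: "\<exists>X\<in>cartan_perp m n. Hh k = H n k (n - k + 1) + X" if "k \<in> {1..m}" for k
    using that Hhat(1)[OF assms(2) that] by (simp add: Hh_def)
  interpret enlarged_chain m n Hp Hh
    by (rule enlarged_chainI[OF assms perp comm hat])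
  interpret frobenius_chain m n Hp Hh
    by unfold_locales (simp add: Hh_def Hhat(2)[OF assms(2)])
  have "?P (Hp, Hh)"
    using Hp Hh perp comm hat r_ech_solves_CYBE by (auto simp: Hp_def Hh_def)
  moreover have "F = (Hp, Hh)" if F: "?P F" for F
  proof (cases F)
    case (Pair Hp' Hh')
    with F have P: "?P (Hp', Hh')" by simp
    have u: "Hp' k = Hp k" "Hh' k = Hh k" if "k \<in> {1..m}" for k
      using enlarged_chain_unique[of m n Hp' Hh' Hp Hh, OF _ _ _ _ that] chain[OF P]
        enlarged_chain_axioms r_ech_solves_CYBE by blast+
    have "Hp' = Hp"
      by (rule PiE_ext[of _ "{1..m}" "\<lambda>_. cartan n"]) (use P \<open>?P (Hp, Hh)\<close> u(1) in auto)
    moreover have "Hh' = Hh"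
      by (rule PiE_ext[of _ "{1..m}" "\<lambda>_. cartan n"]) (use P \<open>?P (Hp, Hh)\<close> u(2) in auto)
    ultimately show ?thesis using Pair by simp
  qed
  ultimately show ?thesis by (rule ex1I)
qed

end
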